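(* For every $a\in\mathcal{O}$ with $|a|_{\mathcal{O}}>0$ there are two equivalence relations $R,S$ on $\omega$, both in $\Sigma^{-1}_a\smallsetminus\Pi^{-1}_a$, which have no infimum with respect to $\leq_c$ in the $\Sigma^{-1}_a$ equivalence relations.
   Context: $R\leq_c S$ means there is a total computable $f$ with $x\mathrel{R}y\Leftrightarrow f(x)\mathrel{S}f(y)$. An infimum of $R,S$ in a class $\mathcal{C}$ is $T\in\mathcal{C}$ with $T\leq_c R$, $T\leq_c S$ and $Z\leq_c T$ for all $Z\in\mathcal{C}$ with $Z\leq_c R,S$. Equivalence relations are identified with subsets of $\omega$ via a computable pairing function. $\mathcal{O}$ is Kleene's system of notations, $|a|_{\mathcal{O}}$ the ordinal denoted by $a$. $A\in\Sigma^{-1}_a$ if there are computable $f(z,t),\gamma(z,t)$ with, for all $z$: $A(z)=\lim_t f(z,t)$, $f(z,0)=0$; $\gamma(z,0)=a$, $\gamma(z,t+1)\leq_{\mathcal{O}}\gamma(z,t)\leq_{\mathcal{O}}a$, and $f(z,t+1)\neq f(z,t)\Rightarrow\gamma(z,t+1)\neq\gamma(z,t)$. $A\in\Pi^{-1}_a$ if $\overline{A}\in\Sigma^{-1}_a$. *)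

theory Defs
  imports Complex_Main "HOL-Library.Nat_Bijection"
begin

text \<open>
  Unary partial recursive functions on the natural numbers. Arguments are tupled with the Cantor
  pairing \<^const>\<open>prod_encode\<close>, so primitive recursion reads its parameter and its counter from one
  input \<^term>\<open>prod_encode (x, n)\<close>, and its step function is applied to
  \<^term>\<open>prod_encode (x, prod_encode (n, v))\<close> where \<^term>\<open>v\<close> is the previous value.
\<close>

datatype prog =
    Zero
  | Succ
  | Proj1
  | Proj2
  | Tup prog prog
  | Comp prog prog
  | PrimRec prog prog
  | Mu prog

text \<open>
  In the clause for \<^const>\<open>Mu\<close>, all computations at arguments below the returned value have to
  converge.
\<close>

primrec run :: "prog \<Rightarrow> nat \<Rightarrow> nat option" where
  "run Zero x = Some 0"
| "run Succ x = Some (Suc x)"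
| "run Proj1 x = Some (fst (prod_decode x))"
| "run Proj2 x = Some (snd (prod_decode x))"
| "run (Tup p q) x =
     Option.bind (run p x) (\<lambda>u. Option.bind (run q x) (\<lambda>v. Some (prod_encode (u, v))))"
| "run (Comp p q) x = Option.bind (run q x) (run p)"
| "run (PrimRec p q) x =
     rec_nat (run p (fst (prod_decode x)))
       (\<lambda>n r. Option.bind r (\<lambda>v. run q (prod_encode (fst (prod_decode x), prod_encode (n, v)))))
       (snd (prod_decode x))"
| "run (Mu p) x =
     (let P = (\<lambda>n. run p (prod_encode (x, n)) = Some 0 \<and>
                   (\<forall>m<n. \<exists>k. run p (prod_encode (x, m)) = Some (Suc k)))
      in if \<exists>n. P n then Some (LEAST n. P n) else None)"

primrec goedel :: "prog \<Rightarrow> nat" where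
  "goedel Zero = 0"
| "goedel Succ = 1"
| "goedel Proj1 = 2"
| "goedel Proj2 = 3"
| "goedel (Tup p q) = 4 * prod_encode (goedel p, goedel q) + 4"
| "goedel (Comp p q) = 4 * prod_encode (goedel p, goedel q) + 5"
| "goedel (PrimRec p q) = 4 * prod_encode (goedel p, goedel q) + 6"
| "goedel (Mu p) = 4 * goedel p + 7"

lemma goedel_inj: "goedel p = goedel q \<Longrightarrow> p = q"
proof (induction p arbitrary: q)
  case Zero then show ?case by (cases q) auto
next
  case Succ then show ?case by (cases q) auto
next
  case Proj1 then show ?case by (cases q) auto
next
  case Proj2 then show ?case by (cases q) auto
next
  case (Tup p1 p2)
  then show ?case by (cases q) (auto, presburger+)
next
  case (Comp p1 p2)
  then show ?case by (cases q) (auto, presburger+)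
next
  case (PrimRec p1 p2)
  then show ?case by (cases q) (auto, presburger+)
next
  case (Mu p)
  then show ?case by (cases q) (auto, presburger+)
qed

lemma goedel_surj: "\<exists>p. goedel p = e"
proof (induction e rule: less_induct)
  case (less e)
  show ?case
  proof (cases "e < 4")
    case True
    then have "e = 0 \<or> e = 1 \<or> e = 2 \<or> e = 3" by auto
    then show ?thesis using goedel.simps(1-4) by metis
  next
    case False
    define m where "m = (e - 4) div 4"
    obtain u v where uv: "m = prod_encode (u, v)"
      by (metis prod_decode_inverse surj_pair)
    have "m < e" using False by (auto simp: m_def)
    then have "u < e" "v < e"
      using le_prod_encode_1[of u v] le_prod_encode_2[of v u] uv by linarith+
    then obtain p q r where "goedel p = u" "goedel q = v" "goedel r = m"
      using less \<open>m < e\<close> by metis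
    moreover have "e = 4 * m + 4 \<or> e = 4 * m + 5 \<or> e = 4 * m + 6 \<or> e = 4 * m + 7"
      using False unfolding m_def by presburger
    ultimately show ?thesis
      using uv goedel.simps(5-8) by metis
  qed
qed

lemma bij_goedel: "bij goedel"
  using goedel_inj goedel_surj by (metis bij_def injI surj_def)

definition phi :: "nat \<Rightarrow> nat \<Rightarrow> nat option" where
  "phi e = run (inv goedel e)"

lemma phi_goedel [simp]: "phi (goedel p) = run p"
  by (simp add: phi_def bij_goedel bij_is_inj)

definition computable :: "(nat \<Rightarrow> nat) \<Rightarrow> bool" where
  "computable f \<longleftrightarrow> (\<exists>e. \<forall>x. phi e x = Some (f x))"

definition computable2 :: "(nat \<Rightarrow> nat \<Rightarrow> nat) \<Rightarrow> bool" where
  "computable2 f \<longleftrightarrow> computable (\<lambda>x. f (fst (prod_decode x)) (snd (prod_decode x)))"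

text \<open>The initial well-order of cardinality \<open>\<aleph>\<^sub>1\<close>, whose elements represent the countable ordinals.\<close>

typedef cord = "Field (cardSuc natLeq)"
  using Field_cardSuc_not_empty[OF natLeq_Card_order] by blast

lemma wo_omega1: "Well_order (cardSuc natLeq)"
  by (rule cardSuc_Well_order[OF natLeq_Card_order])

instantiation cord :: wellorder
begin

definition less_eq_cord :: "cord \<Rightarrow> cord \<Rightarrow> bool" where
  "x \<le> y \<longleftrightarrow> (Rep_cord x, Rep_cord y) \<in> cardSuc natLeq"

definition less_cord :: "cord \<Rightarrow> cord \<Rightarrow> bool" where
  "(x::cord) < y \<longleftrightarrow> x \<le> y \<and> \<not> y \<le> x"

instance
proof
  note wo = wo_omega1[unfolded well_order_on_def linear_order_on_def partial_order_on_def
      preorder_on_def]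
  show "(x < y) = (x \<le> y \<and> \<not> y \<le> x)" for x y :: cord
    by (rule less_cord_def)
  show "x \<le> x" for x :: cord
    using wo Rep_cord[of x] unfolding less_eq_cord_def refl_on_def by blast
  show "x \<le> y \<Longrightarrow> y \<le> z \<Longrightarrow> x \<le> z" for x y z :: cord
    using wo unfolding less_eq_cord_def trans_def by blast
  show asym: "x \<le> y \<Longrightarrow> y \<le> x \<Longrightarrow> x = y" for x y :: cord
    using wo unfolding less_eq_cord_def antisym_def by (metis Rep_cord_inject)
  show "x \<le> y \<or> y \<le> x" for x y :: cord
    using wo Rep_cord[of x] Rep_cord[of y] unfolding less_eq_cord_def total_on_def refl_on_def
    by (metis Rep_cord_inject)
  show "P a" if step: "\<And>x. (\<And>y. y < x \<Longrightarrow> P y) \<Longrightarrow> P x" for P and a :: cord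
  proof -
    have "wf (cardSuc natLeq - Id)" using wo by blast
    then have "wf (inv_image (cardSuc natLeq - Id) Rep_cord)" by (rule wf_inv_image)
    moreover have "(y, x) \<in> inv_image (cardSuc natLeq - Id) Rep_cord" if "y < x" for x y
      using that asym by (auto simp: less_cord_def less_eq_cord_def inv_image_def Rep_cord_inject)
    ultimately show ?thesis
      using step by (metis wf_induct_rule)
  qed
qed

end

instantiation cord :: zero
begin
definition zero_cord :: cord where "0 = (LEAST \<alpha>::cord. True)"
instance ..
end

definition cord_succ :: "cord \<Rightarrow> cord" where
  "cord_succ \<alpha> = (LEAST \<beta>. \<alpha> < \<beta>)"

definition cord_sup :: "(nat \<Rightarrow> cord) \<Rightarrow> cord" where
  "cord_sup \<alpha> = (LEAST \<beta>. \<forall>n. \<alpha> n \<le> \<beta>)"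

lemma zero_cord_le [simp]: "(0::cord) \<le> \<alpha>"
  by (simp add: zero_cord_def Least_le)

lemma cord_strict_upper_bound:
  fixes \<alpha> :: "nat \<Rightarrow> cord"
  shows "\<exists>\<beta>. \<forall>n. \<alpha> n < \<beta>"
proof (rule ccontr)
  assume neg: "\<not> ?thesis"
  let ?r = "cardSuc natLeq" and ?K = "range (\<lambda>n. Rep_cord (\<alpha> n))"
  have fin: "\<not> finite (Field natLeq)" by (simp add: Field_natLeq)
  have cofin: "?K \<subseteq> Field ?r" using Rep_cord by blast
  have "\<exists>b\<in>?K. c \<noteq> b \<and> (c, b) \<in> ?r" if c: "c \<in> Field ?r" for c
  proof -
    obtain x where x: "c = Rep_cord x" using c by (metis Rep_cord_cases)
    have "\<exists>y. x < y"
    proof -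
      obtain d where "d \<in> Field ?r" "c \<noteq> d" "(c, d) \<in> ?r"
        using infinite_Card_order_limit[OF cardSuc_Card_order[OF natLeq_Card_order] _ c]
          cardSuc_finite[OF natLeq_Card_order] fin by blast
      then show ?thesis
        using x by (metis Rep_cord_cases less_eq_cord_def order_le_less)
    qed
    then obtain y where y: "x < y" by blast
    then obtain n where "y \<le> \<alpha> n" using neg by (meson not_le)
    then have "x < \<alpha> n" using y by simp
    then have "c \<noteq> Rep_cord (\<alpha> n)" "(c, Rep_cord (\<alpha> n)) \<in> ?r"
      using x by (auto simp: less_cord_def less_eq_cord_def)
    then show ?thesis by blast
  qed
  then have "cofinal ?K ?r" unfolding cofinal_def by blast
  then have "(card_of ?K, ?r) \<in> ordIso"
    using infinite_cardSuc_regularCard[OF fin natLeq_Card_order] cofin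
    unfolding regularCard_def by blast
  moreover have "(card_of ?K, natLeq) \<in> ordLeq"
    using card_of_image card_of_nat ordLeq_ordIso_trans by blast
  then have "(card_of ?K, ?r) \<in> ordLess"
    using cardSuc_greater[OF natLeq_Card_order] ordLeq_ordLess_trans by blast
  ultimately show False using not_ordLess_ordIso by blast
qed

lemma less_cord_succ: "\<alpha> < cord_succ \<alpha>"
  unfolding cord_succ_def using cord_strict_upper_bound[of "\<lambda>_. \<alpha>"] by (metis LeastI)

lemma cord_succ_le: "\<alpha> < \<beta> \<Longrightarrow> cord_succ \<alpha> \<le> \<beta>"
  unfolding cord_succ_def by (rule Least_le)

lemma le_cord_sup: "\<alpha> n \<le> cord_sup \<alpha>"
proof -
  have "\<exists>\<beta>. \<forall>n. \<alpha> n \<le> \<beta>" using cord_strict_upper_bound[of \<alpha>] by (meson less_imp_le)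
  from LeastI_ex[OF this] show ?thesis unfolding cord_sup_def by blast
qed

lemma cord_sup_le: "(\<And>n. \<alpha> n \<le> \<beta>) \<Longrightarrow> cord_sup \<alpha> \<le> \<beta>"
  unfolding cord_sup_def by (simp add: Least_le)

text \<open>
  \<^prop>\<open>KO a\<close> means \<open>a \<in> \<O>\<close> and \<^term>\<open>KO_less\<close> is \<open><\<^sub>\<O>\<close>. A limit notation \<open>3 * 5 ^ e\<close> takes its fundamental
  sequence \<open>\<phi>\<^sub>e(0), \<phi>\<^sub>e(1), \<dots>\<close> at the numbers themselves, not at their notations.
\<close>

inductive KO :: "nat \<Rightarrow> bool" and KO_less :: "nat \<Rightarrow> nat \<Rightarrow> bool" where
  KO_one: "KO 1"
| KO_succ: "KO a \<Longrightarrow> KO (2 ^ a)"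
| KO_lim: "(\<And>n. phi e n = Some (h n)) \<Longrightarrow> (\<And>n. KO (h n)) \<Longrightarrow> (\<And>n. KO_less (h n) (h (Suc n)))
    \<Longrightarrow> KO (3 * 5 ^ e)"
| KO_less_succ: "KO a \<Longrightarrow> KO_less a (2 ^ a)"
| KO_less_lim: "(\<And>n. phi e n = Some (h n)) \<Longrightarrow> (\<And>n. KO (h n)) \<Longrightarrow> (\<And>n. KO_less (h n) (h (Suc n)))
    \<Longrightarrow> KO_less (h k) (3 * 5 ^ e)"
| KO_less_trans: "KO_less a b \<Longrightarrow> KO_less b c \<Longrightarrow> KO_less a c"

definition KO_le :: "nat \<Rightarrow> nat \<Rightarrow> bool" where
  "KO_le a b \<longleftrightarrow> KO_less a b \<or> (KO a \<and> a = b)"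

inductive denotes :: "nat \<Rightarrow> cord \<Rightarrow> bool" where
  denotes_one: "denotes 1 0"
| denotes_succ: "KO a \<Longrightarrow> denotes a \<alpha> \<Longrightarrow> denotes (2 ^ a) (cord_succ \<alpha>)"
| denotes_lim: "KO (3 * 5 ^ e) \<Longrightarrow> (\<And>n. phi e n = Some (h n)) \<Longrightarrow> (\<And>n. denotes (h n) (\<alpha> n))
    \<Longrightarrow> denotes (3 * 5 ^ e) (cord_sup \<alpha>)"

definition KO_ord :: "nat \<Rightarrow> cord" where
  "KO_ord a = (THE \<alpha>. denotes a \<alpha>)"

lemma KO_pos: "KO a \<Longrightarrow> 0 < a"
  by (induction rule: KO.cases) auto

lemma two_power_neq_lim: "(2::nat) ^ a \<noteq> 3 * 5 ^ e"
proof
  assume eq: "(2::nat) ^ a = 3 * 5 ^ e"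
  have "odd ((3::nat) * 5 ^ e)" by simp
  then have "a = 0" using eq by (metis even_power even_numeral not_gr0 neq0_conv)
  then show False using eq by (simp add: power_0)
qed

lemma two_power_neq_one: "KO a \<Longrightarrow> (2::nat) ^ a \<noteq> 1"
  using KO_pos by (metis nat_power_eq_Suc_0_iff One_nat_def less_irrefl numeral_eq_one_iff
      semiring_norm(85))

lemma lim_neq_one: "(3::nat) * 5 ^ e \<noteq> 1"
  by simp

lemma lim_inj: "(3::nat) * 5 ^ e = 3 * 5 ^ e' \<Longrightarrow> e = e'"
  by simp

lemma denotes_unique: "denotes a \<alpha> \<Longrightarrow> denotes a \<beta> \<Longrightarrow> \<alpha> = \<beta>"
proof (induction arbitrary: \<beta> rule: denotes.induct)
  case denotes_one
  from denotes_one show ?case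
    by (cases rule: denotes.cases) (use two_power_neq_one in force)+
next
  case (denotes_succ a \<alpha>)
  from denotes_succ.prems show ?case
  proof (cases rule: denotes.cases)
    case denotes_one
    then show ?thesis using two_power_neq_one[OF denotes_succ.hyps(1)] by simp
  next
    case (denotes_succ b \<gamma>)
    then show ?thesis using \<open>\<And>\<beta>. denotes a \<beta> \<Longrightarrow> \<alpha> = \<beta>\<close> by simp
  next
    case (denotes_lim e h \<gamma>)
    then show ?thesis using two_power_neq_lim by simp
  qed
next
  case (denotes_lim e h \<alpha>)
  note L = denotes_lim
  from denotes_lim.prems show ?case
  proof (cases rule: denotes.cases)
    case denotes_one
    then show ?thesis using lim_neq_one by metis
  next
    case (denotes_succ b \<gamma>)
    then show ?thesis using two_power_neq_lim by metis
  next
    case (denotes_lim e' h' \<gamma>)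
    then have "e' = e" by simp
    then have "h' n = h n" for n using denotes_lim L(2) by (metis option.inject)
    then have "\<alpha> = \<gamma>" using denotes_lim L(4) by (metis ext)
    then show ?thesis using denotes_lim by simp
  qed
qed

lemma denotes_exists: "KO a \<Longrightarrow> \<exists>\<alpha>. denotes a \<alpha>"
  and "KO_less a b \<Longrightarrow> True"
proof (induction rule: KO_KO_less.inducts)
  case (KO_lim e h)
  then have "\<exists>\<alpha>. \<forall>n. denotes (h n) (\<alpha> n)" by (intro choice) blast
  then show ?case using denotes_lim KO_KO_less.KO_lim KO_lim by meson
qed (auto intro: denotes.intros simp flip: One_nat_def)

lemma KO_ord_eq: "denotes a \<alpha> \<Longrightarrow> KO_ord a = \<alpha>"
  unfolding KO_ord_def using denotes_unique by blast

lemma denotes_KO_ord: "KO a \<Longrightarrow> denotes a (KO_ord a)"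
  using denotes_exists KO_ord_eq by metis

lemma KO_ord_one: "KO_ord 1 = 0"
  by (rule KO_ord_eq[OF denotes_one])

lemma KO_ord_succ: "KO a \<Longrightarrow> KO_ord (2 ^ a) = cord_succ (KO_ord a)"
  by (rule KO_ord_eq[OF denotes_succ[OF _ denotes_KO_ord]])

lemma KO_ord_lim:
  assumes "\<And>n. phi e n = Some (h n)" "\<And>n. KO (h n)" "\<And>n. KO_less (h n) (h (Suc n))"
  shows "KO_ord (3 * 5 ^ e) = cord_sup (\<lambda>n. KO_ord (h n))"
  by (rule KO_ord_eq[OF denotes_lim]) (use assms KO_lim denotes_KO_ord in blast)+

lemma KO_ord_less: "KO a \<Longrightarrow> True" "KO_less a b \<Longrightarrow> KO_ord a < KO_ord b"
proof (induction rule: KO_KO_less.inducts)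
  case (KO_less_succ a)
  then show ?case by (simp add: KO_ord_succ less_cord_succ)
next
  case (KO_less_lim e h k)
  then have "KO_ord (h k) < KO_ord (h (Suc k))" by blast
  also have "\<dots> \<le> cord_sup (\<lambda>n. KO_ord (h n))" by (rule le_cord_sup)
  also have "\<dots> = KO_ord (3 * 5 ^ e)" using KO_ord_lim KO_less_lim by metis
  finally show ?case .
qed auto

definition Sigma_inv :: "nat \<Rightarrow> nat set set" where
  "Sigma_inv a = {A. \<exists>f \<gamma>. computable2 f \<and> computable2 \<gamma> \<and>
     (\<forall>z. (\<lambda>t. f z t) \<longlonglongrightarrow> of_bool (z \<in> A) \<and> f z 0 = 0 \<and> \<gamma> z 0 = a \<and>
       (\<forall>t. KO_le (\<gamma> z (Suc t)) (\<gamma> z t) \<and> KO_le (\<gamma> z t) a \<and>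
            (f z (Suc t) \<noteq> f z t \<longrightarrow> \<gamma> z (Suc t) \<noteq> \<gamma> z t)))}"

definition Pi_inv :: "nat \<Rightarrow> nat set set" where
  "Pi_inv a = {A. - A \<in> Sigma_inv a}"

definition rel_code :: "nat rel \<Rightarrow> nat set" where
  "rel_code R = prod_encode ` R"

definition Sigma_equivs :: "nat \<Rightarrow> nat rel set" where
  "Sigma_equivs a = {R. equiv UNIV R \<and> rel_code R \<in> Sigma_inv a}"

definition reducible :: "nat rel \<Rightarrow> nat rel \<Rightarrow> bool"  (infix "\<le>\<^sub>c" 50) where
  "R \<le>\<^sub>c S \<longleftrightarrow> (\<exists>f. computable f \<and> (\<forall>x y. (x, y) \<in> R \<longleftrightarrow> (f x, f y) \<in> S))"

definition is_infimum :: "nat rel set \<Rightarrow> nat rel \<Rightarrow> nat rel \<Rightarrow> nat rel \<Rightarrow> bool" where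
  "is_infimum C R S T \<longleftrightarrow>
     T \<in> C \<and> T \<le>\<^sub>c R \<and> T \<le>\<^sub>c S \<and> (\<forall>Z\<in>C. Z \<le>\<^sub>c R \<and> Z \<le>\<^sub>c S \<longrightarrow> Z \<le>\<^sub>c T)"

end

theory Submission
  imports Defs
begin

text \<open>
  Both relations live on the twin pairs \<open>{2z, 2z + 1}\<close>. An untouched pair is isolated, and its twins
  are equivalent according to the trajectory of a candidate for a \<open>\<Sigma>\<close>-approximation coded in \<open>z\<close>, run on
  the code of \<open>(2z, 2z + 1)\<close>; as every candidate owns a pair that stays untouched, the complement of
  the relation is not in \<open>\<Sigma>\<close>. Touching a pair freezes its trajectory and distributes the twins over two
  large classes \<open>0\<close> and \<open>1\<close>, together if they are equivalent at that moment and apart otherwise. So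
  freezing never costs an additional change of mind, and elements of different pairs become equivalent
  at most once.

  A pair \<open>(\<phi>\<^sub>i, \<phi>\<^sub>j)\<close> of potential reductions of one relation \<open>T\<close> to \<open>R\<close> and \<open>S\<close> acts at most once: on
  finding \<open>x, y\<close> whose four images lie in untouched pairs, it merges \<open>\<phi>\<^sub>i x\<close>, \<open>\<phi>\<^sub>i y\<close> in \<open>R\<close> and
  permanently separates \<open>\<phi>\<^sub>j x\<close>, \<open>\<phi>\<^sub>j y\<close> in \<open>S\<close>. There is no injury. If \<open>T\<close> has infinitely many
  classes, such \<open>x, y\<close> exist, hence common lower bounds of \<open>R\<close> and \<open>S\<close> have finitely many classes. But
  \<open>R\<close> and \<open>S\<close> have infinitely many, so every relation with \<open>n\<close> decidable classes lies below both, and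
  no common lower bound is the greatest.
\<close>

section \<open>Closure properties of the computable functions\<close>

definition pi1 :: "nat \<Rightarrow> nat" where "pi1 x = fst (prod_decode x)"
definition pi2 :: "nat \<Rightarrow> nat" where "pi2 x = snd (prod_decode x)"

abbreviation pr :: "nat \<Rightarrow> nat \<Rightarrow> nat" where "pr x y \<equiv> prod_encode (x, y)"

lemma pi_pr [simp]: "pi1 (pr x y) = x" "pi2 (pr x y) = y" "pr (pi1 z) (pi2 z) = z"
  by (simp_all add: pi1_def pi2_def)

lemma computable_iff_run: "computable f \<longleftrightarrow> (\<exists>p. \<forall>x. run p x = Some (f x))"
  unfolding computable_def using goedel_surj phi_goedel by metis

lemma computable2_iff: "computable2 f \<longleftrightarrow> computable (\<lambda>x. f (pi1 x) (pi2 x))"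
  by (simp add: computable2_def pi1_def pi2_def)

named_theorems cintro

lemma computable_id [cintro]: "computable (\<lambda>x. x)"
proof -
  have "\<forall>x. run (Tup Proj1 Proj2) x = Some x" by simp
  then show ?thesis unfolding computable_iff_run by blast
qed

lemma computable_comp:
  assumes "computable f" "computable g"
  shows "computable (\<lambda>x. f (g x))"
proof -
  obtain p q where "\<forall>x. run p x = Some (f x)" "\<forall>x. run q x = Some (g x)"
    using assms unfolding computable_iff_run by blast
  then have "\<forall>x. run (Comp p q) x = Some (f (g x))" by simp
  then show ?thesis unfolding computable_iff_run by blast
qed

lemma computable_Suc [cintro]: "computable f \<Longrightarrow> computable (\<lambda>x. Suc (f x))"
  by (rule computable_comp[of Suc]) (auto simp: computable_iff_run intro: exI[of _ Succ])

lemma computable_pi1 [cintro]: "computable f \<Longrightarrow> computable (\<lambda>x. pi1 (f x))"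
  by (rule computable_comp[of pi1]) (auto simp: computable_iff_run pi1_def intro: exI[of _ Proj1])

lemma computable_pi2 [cintro]: "computable f \<Longrightarrow> computable (\<lambda>x. pi2 (f x))"
  by (rule computable_comp[of pi2]) (auto simp: computable_iff_run pi2_def intro: exI[of _ Proj2])

lemma computable_pr [cintro]:
  assumes "computable f" "computable g"
  shows "computable (\<lambda>x. pr (f x) (g x))"
proof -
  obtain p q where "\<forall>x. run p x = Some (f x)" "\<forall>x. run q x = Some (g x)"
    using assms unfolding computable_iff_run by blast
  then have "\<forall>x. run (Tup p q) x = Some (pr (f x) (g x))" by simp
  then show ?thesis unfolding computable_iff_run by blast
qed

lemma computable_const [cintro]: "computable (\<lambda>x. c)"
proof (induction c)
  case 0
  have "\<forall>x. run Zero x = Some 0" by simp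
  then show ?case unfolding computable_iff_run by blast
next
  case (Suc c)
  then show ?case by (rule computable_Suc)
qed

lemma computable_comp2:
  assumes "computable (\<lambda>z. h (pi1 z) (pi2 z))" "computable f" "computable g"
  shows "computable (\<lambda>x. h (f x) (g x))"
  using computable_comp[OF assms(1) computable_pr[OF assms(2,3)]] by simp

lemma computable_comp3:
  assumes "computable (\<lambda>z. h (pi1 z) (pi1 (pi2 z)) (pi2 (pi2 z)))"
    "computable f" "computable g" "computable k"
  shows "computable (\<lambda>x. h (f x) (g x) (k x))"
  using computable_comp[OF assms(1) computable_pr[OF assms(2) computable_pr[OF assms(3,4)]]] by simp

text \<open>The step function also receives the outer argument \<open>x\<close>, which is what
  \<open>PrimRec\<close> offers as its parameter; composing with the pair of \<open>x\<close> and
  \<open>m x\<close> allows any computable counter.\<close>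

lemma computable_rec [cintro]:
  assumes "computable g" "computable (\<lambda>z. h (pi1 z) (pi1 (pi2 z)) (pi2 (pi2 z)))" "computable m"
  shows "computable (\<lambda>x. rec_nat (g x) (h x) (m x))"
proof -
  obtain p q where p: "\<And>x. run p x = Some (g x)"
    and q: "\<And>z. run q z = Some (h (pi1 z) (pi1 (pi2 z)) (pi2 (pi2 z)))"
    using assms unfolding computable_iff_run by blast
  have "run (PrimRec p q) (pr x n) = Some (rec_nat (g x) (h x) n)" for x n
    by (induction n) (simp_all add: p q)
  then have "run (PrimRec p q) z = Some (rec_nat (g (pi1 z)) (h (pi1 z)) (pi2 z))" for z
    by (metis pi_pr(3))
  then have "computable (\<lambda>z. rec_nat (g (pi1 z)) (h (pi1 z)) (pi2 z))"
    unfolding computable_iff_run by blast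
  from computable_comp2[of "\<lambda>x. rec_nat (g x) (h x)", OF this computable_id assms(3)]
  show ?thesis .
qed

lemma computable_add [cintro]:
  assumes "computable f" "computable g" shows "computable (\<lambda>x. f x + g x)"
proof -
  have "x + y = rec_nat x (\<lambda>_ v. Suc v) y" for x y :: nat by (induction y) auto
  then show ?thesis using assms by (simp only:) (intro cintro)
qed

lemma computable_pred: "computable f \<Longrightarrow> computable (\<lambda>x. f x - 1)"
proof -
  assume f: "computable f"
  have "y - 1 = rec_nat 0 (\<lambda>n v. n) y" for y :: nat by (cases y) auto
  then show ?thesis using f by (simp only:) (intro cintro)
qed

lemma computable_diff [cintro]:
  assumes "computable f" "computable g" shows "computable (\<lambda>x. f x - g x)"
proof -
  have "rec_nat x (\<lambda>_ v. v - 1) y = x - y" for x y :: nat by (induction y) auto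
  moreover have "computable (\<lambda>x. rec_nat (f x) (\<lambda>_ v. v - 1) (g x))"
    using assms by (intro cintro computable_pred)
  ultimately show ?thesis by simp
qed

lemma computable_mult [cintro]:
  assumes "computable f" "computable g" shows "computable (\<lambda>x. f x * g x)"
proof -
  have "x * y = rec_nat 0 (\<lambda>_ v. x + v) y" for x y :: nat by (induction y) auto
  then have "computable (\<lambda>z. pi1 z * pi2 z)" by (simp only:) (intro cintro)
  then show ?thesis by (rule computable_comp2) (rule assms)+
qed

lemma computable_power [cintro]:
  assumes "computable f" "computable g" shows "computable (\<lambda>x. f x ^ g x)"
proof -
  have "x ^ y = rec_nat 1 (\<lambda>_ v. x * v) y" for x y :: nat by (induction y) auto
  then have "computable (\<lambda>z. pi1 z ^ pi2 z)" by (simp only:) (intro cintro)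
  then show ?thesis by (rule computable_comp2) (rule assms)+
qed

section \<open>Decidable predicates and bounded search\<close>

definition dec :: "(nat \<Rightarrow> bool) \<Rightarrow> bool" where
  "dec P \<longleftrightarrow> computable (\<lambda>x. of_bool (P x))"

lemma computable_of_bool [cintro]: "dec P \<Longrightarrow> computable (\<lambda>x. of_bool (P x))"
  by (simp add: dec_def)

lemma computable_if [cintro]:
  assumes "dec P" "computable f" "computable g"
  shows "computable (\<lambda>x. if P x then f x else g x)"
proof -
  have "(if b then y else z) = rec_nat z (\<lambda>_ _. y) (of_bool b)" for b and y z :: nat by simp
  moreover have "computable (\<lambda>x. f (pi1 x))"
    by (rule computable_comp[OF assms(2)]) (intro cintro)
  ultimately show ?thesis using assms by (simp only:) (intro cintro)
qed

lemma dec_not [cintro]: assumes "dec P" shows "dec (\<lambda>x. \<not> P x)"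
proof -
  have "of_bool (\<not> b) = (1::nat) - of_bool b" for b by simp
  then show ?thesis using assms unfolding dec_def by (simp only:) (intro cintro, (simp only: dec_def)+)
qed

lemma dec_conj [cintro]: assumes "dec P" "dec Q" shows "dec (\<lambda>x. P x \<and> Q x)"
proof -
  have "of_bool (a \<and> b) = (of_bool a * of_bool b :: nat)" for a b by simp
  then show ?thesis using assms unfolding dec_def by (simp only:) (intro cintro, (simp only: dec_def)+)
qed

lemma dec_disj [cintro]: assumes "dec P" "dec Q" shows "dec (\<lambda>x. P x \<or> Q x)"
proof -
  have "dec (\<lambda>x. \<not> (\<not> P x \<and> \<not> Q x))" using assms by (intro cintro)
  then show ?thesis by simp
qed

lemma dec_imp [cintro]: assumes "dec P" "dec Q" shows "dec (\<lambda>x. P x \<longrightarrow> Q x)"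
proof -
  have "dec (\<lambda>x. \<not> P x \<or> Q x)" using assms by (intro cintro)
  then show ?thesis unfolding imp_conv_disj .
qed

lemma dec_if [cintro]:
  assumes "dec P" "dec Q" "dec R" shows "dec (\<lambda>x. if P x then Q x else R x)"
proof -
  have "dec (\<lambda>x. (P x \<longrightarrow> Q x) \<and> (\<not> P x \<longrightarrow> R x))" using assms by (intro cintro)
  then show ?thesis unfolding if_bool_eq_conj .
qed

lemma dec_le [cintro]:
  assumes "computable f" "computable g" shows "dec (\<lambda>x. f x \<le> g x)"
proof -
  have "of_bool (x \<le> y) = (1 - (x - y) :: nat)" for x y :: nat by simp
  then show ?thesis using assms unfolding dec_def by (simp only:) (intro cintro, (simp only: dec_def)+)
qed

lemma dec_less [cintro]:
  assumes "computable f" "computable g" shows "dec (\<lambda>x. f x < g x)"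
proof -
  have "dec (\<lambda>x. Suc (f x) \<le> g x)" using assms by (intro cintro)
  then show ?thesis by (simp add: Suc_le_eq)
qed

lemma dec_eq [cintro]:
  assumes "computable f" "computable g" shows "dec (\<lambda>x. f x = g x)"
proof -
  have "dec (\<lambda>x. f x \<le> g x \<and> g x \<le> f x)" using assms by (intro cintro)
  then show ?thesis by (simp add: eq_iff)
qed

lemma dec_comp2:
  assumes "dec (\<lambda>z. P (pi1 z) (pi2 z))" "computable f" "computable g"
  shows "dec (\<lambda>x. P (f x) (g x))"
  using assms computable_comp2[of "\<lambda>x y. of_bool (P x y)" f g] unfolding dec_def by simp

lemma dec_ball [cintro]:
  assumes "computable b" "dec (\<lambda>z. P (pi1 z) (pi2 z))"
  shows "dec (\<lambda>x. \<forall>m < b x. P x m)"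
proof -
  have *: "of_bool (\<forall>m<n. Q m) = rec_nat (1::nat) (\<lambda>m v. v * of_bool (Q m)) n" for Q and n :: nat
  proof (induction n)
    case (Suc n)
    have "(\<forall>m<Suc n. Q m) \<longleftrightarrow> (\<forall>m<n. Q m) \<and> Q n" by (auto simp: less_Suc_eq)
    then show ?case by (simp only: of_bool_conj Suc nat.rec(2))
  qed simp
  have "dec (\<lambda>z. P (pi1 z) (pi1 (pi2 z)))"
    by (rule dec_comp2[OF assms(2)]) (intro cintro)+
  then show ?thesis using assms(1) unfolding dec_def * by (intro cintro) (simp_all add: dec_def)
qed

lemma dec_bex [cintro]:
  assumes "computable b" "dec (\<lambda>z. P (pi1 z) (pi2 z))"
  shows "dec (\<lambda>x. \<exists>m < b x. P x m)"
proof -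
  have "dec (\<lambda>x. \<not> (\<forall>m < b x. \<not> P x m))" using assms by (intro cintro)
  then show ?thesis by simp
qed

lemma computable_bounded_Least [cintro]:
  assumes "computable b" "dec (\<lambda>z. P (pi1 z) (pi2 z))"
  shows "computable (\<lambda>x. LEAST m. b x \<le> m \<or> P x m)"
proof -
  let ?L = "\<lambda>Q n. LEAST m. n \<le> m \<or> Q (m::nat)"
  \<comment> \<open>A value \<open>v < m\<close> records a witness already found;
    \<open>v = m\<close> means that there is none below \<open>m\<close>.\<close>
  let ?r = "\<lambda>Q. rec_nat 0 (\<lambda>m v. if v < m then v else if Q m then m else Suc m)"
  have *: "?L Q n = ?r Q n" for Q n
  proof (induction n)
    case (Suc n)
    have L: "?L Q n \<le> n" by (rule Least_le) simp
    have L1: "n \<le> ?L Q n \<or> Q (?L Q n)" by (rule LeastI[of _ n]) simp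
    have L2: "\<not> Q m" if "m < ?L Q n" for m using not_less_Least[OF that] by simp
    have "?L Q (Suc n) = (if ?L Q n < n then ?L Q n else if Q n then n else Suc n)"
    proof (rule Least_equality)
      show "Suc n \<le> (if ?L Q n < n then ?L Q n else if Q n then n else Suc n) \<or>
        Q (if ?L Q n < n then ?L Q n else if Q n then n else Suc n)"
        using L1 by auto
    next
      fix y assume "Suc n \<le> y \<or> Q y"
      then show "(if ?L Q n < n then ?L Q n else if Q n then n else Suc n) \<le> y"
        using L L2[of y] by (smt (verit, best) le_less_linear le_less_trans less_Suc_eq_le nat_neq_iff not_less_eq_eq order.asym)
    qed
    then show ?case by (simp add: Suc)
  qed simp
  have P: "dec (\<lambda>z. P (pi1 z) (pi1 (pi2 z)))"
    by (rule dec_comp2[OF assms(2)]) (intro cintro)+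
  show ?thesis unfolding * using assms(1) P by (intro cintro)
qed

lemma computable_div [cintro]:
  assumes "computable f" "computable g" shows "computable (\<lambda>x. f x div g x)"
proof -
  have "x div y = (if y = 0 then 0 else LEAST q. x \<le> q \<or> x < Suc q * y)" for x y :: nat
  proof (cases "y = 0")
    case False
    have "(LEAST q. x \<le> q \<or> x < Suc q * y) = x div y"
    proof (rule Least_equality)
      show "x \<le> x div y \<or> x < Suc (x div y) * y"
        using False by (metis dividend_less_div_times mult_Suc not_gr0)
      fix q assume "x \<le> q \<or> x < Suc q * y"
      then show "x div y \<le> q"
        using False by (metis div_le_dividend le_trans less_Suc_eq_le less_mult_imp_div_less)
    qed
    then show ?thesis using False by simp
  qed simp
  then have "computable (\<lambda>z. pi1 z div pi2 z)" by (simp only:) (intro cintro)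
  then show ?thesis by (rule computable_comp2) (rule assms)+
qed

lemma dec_even [cintro]: assumes "computable f" shows "dec (\<lambda>x. even (f x))"
proof -
  have "even n \<longleftrightarrow> 2 * (n div 2) = n" for n :: nat by presburger
  then show ?thesis using assms by (simp only:) (intro cintro)
qed

lemma computable_mod [cintro]:
  assumes "computable f" "computable g" shows "computable (\<lambda>x. f x mod g x)"
  using assms by (simp only: modulo_nat_def) (intro cintro)

lemma dec_mem_set_decode [cintro]:
  assumes "computable f" "computable g" shows "dec (\<lambda>x. f x \<in> set_decode (g x))"
  using assms by (simp only: set_decode_def mem_Collect_eq) (intro cintro)

text \<open>\<open>r\<close> is arbitrary: for fixed \<open>n\<close> only the values
  \<open>r 0, ..., r n\<close> occur, and they are built in as constants. So a noneffective choice
  of representatives can still yield a reduction.\<close>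

lemma computable_initial_segment: "computable (\<lambda>x. r (min x n))"
proof (induction n)
  case (Suc n)
  have "r (min x (Suc n)) = (if x \<le> n then r (min x n) else r (Suc n))" for x
    by (cases "x \<le> n") (auto simp: min_def le_Suc_eq)
  then show ?case using Suc by (simp only:) (intro cintro)
qed (simp add: computable_const)

section \<open>Certificates of convergence and descent\<close>

text \<open>Membership in Kleene's O is not demanded, so that a finite path can be certified by
  finitely many computations. The condition \<open>0 < c\<close> keeps \<open>1 = 2 ^ 0\<close> from
  having a predecessor.\<close>

definition o_step :: "nat \<Rightarrow> nat \<Rightarrow> bool" where
  "o_step d c \<longleftrightarrow> d = 2 ^ c \<and> 0 < c \<or> (\<exists>e n. d = 3 * 5 ^ e \<and> phi e n = Some c)"

text \<open>
  Convergence \<open>\<phi>\<^sub>e x = v\<close> and descent along \<open><\<^sub>\<O>\<close> are witnessed by finite sets of ranked facts, in which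
  every fact follows by one rule from facts of smaller rank. Checking such a set involves only
  bounded quantifiers, so no step-counting interpreter is needed. The parameter \<open>B\<close> of the rules bounds
  their existential quantifiers.
\<close>

definition run_fact :: "nat \<Rightarrow> nat \<Rightarrow> nat \<Rightarrow> nat" where
  "run_fact e x v = pr 0 (pr e (pr x v))"

definition path_fact :: "nat \<Rightarrow> nat \<Rightarrow> nat" where
  "path_fact b c = pr 1 (pr b c)"

definition holds :: "nat \<Rightarrow> bool" where
  "holds y \<longleftrightarrow>
     (if pi1 y = 0 then phi (pi1 (pi2 y)) (pi1 (pi2 (pi2 y))) = Some (pi2 (pi2 (pi2 y)))
      else o_step\<^sup>*\<^sup>* (pi1 (pi2 y)) (pi2 (pi2 y)))"

lemma holds_run_fact [simp]: "holds (run_fact e x v) \<longleftrightarrow> phi e x = Some v"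
  by (simp add: holds_def run_fact_def)

lemma holds_path_fact [simp]: "holds (path_fact b c) \<longleftrightarrow> o_step\<^sup>*\<^sup>* b c"
  by (simp add: holds_def path_fact_def)

text \<open>\<open>e mod 4\<close> and \<open>(e - 4) div 4\<close> invert \<open>goedel\<close>.
  With a positive counter the \<open>PrimRec\<close> clause refers back to the same code
  \<open>e\<close>, so well-foundedness has to come from the ranks, not from the size of the
  program.\<close>

definition run_rule :: "nat \<Rightarrow> (nat \<Rightarrow> bool) \<Rightarrow> nat \<Rightarrow> nat \<Rightarrow> nat \<Rightarrow> bool" where
  "run_rule B P e x v \<longleftrightarrow>
     e = 0 \<and> v = 0 \<or> e = 1 \<and> v = Suc x \<or> e = 2 \<and> v = pi1 x \<or> e = 3 \<and> v = pi2 x \<or>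
     4 \<le> e \<and>
      (e mod 4 = 0 \<and> P (run_fact (pi1 ((e - 4) div 4)) x (pi1 v))
                   \<and> P (run_fact (pi2 ((e - 4) div 4)) x (pi2 v)) \<or>
       e mod 4 = 1 \<and> (\<exists>u<B. P (run_fact (pi2 ((e - 4) div 4)) x u)
                          \<and> P (run_fact (pi1 ((e - 4) div 4)) u v)) \<or>
       e mod 4 = 2 \<and> pi2 x = 0 \<and> P (run_fact (pi1 ((e - 4) div 4)) (pi1 x) v) \<or>
       e mod 4 = 2 \<and> 0 < pi2 x \<and>
         (\<exists>w<B. P (run_fact e (pr (pi1 x) (pi2 x - 1)) w) \<and>
              P (run_fact (pi2 ((e - 4) div 4)) (pr (pi1 x) (pr (pi2 x - 1) w)) v)) \<or>
       e mod 4 = 3 \<and> P (run_fact ((e - 4) div 4) (pr x v) 0) \<and>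
         (\<forall>n<v. \<exists>u<B. P (run_fact ((e - 4) div 4) (pr x n) (Suc u))))"

definition path_rule :: "nat \<Rightarrow> (nat \<Rightarrow> bool) \<Rightarrow> nat \<Rightarrow> nat \<Rightarrow> bool" where
  "path_rule B P b c \<longleftrightarrow>
     b = c \<or> (\<exists>d<B. P (path_fact b d) \<and>
       (d = 2 ^ c \<and> 0 < c \<or> (\<exists>e<B. \<exists>n<B. d = 3 * 5 ^ e \<and> P (run_fact e n c))))"

definition rule :: "nat \<Rightarrow> (nat \<Rightarrow> bool) \<Rightarrow> nat \<Rightarrow> bool" where
  "rule B P y \<longleftrightarrow>
     pi1 y = 0 \<and> run_rule B P (pi1 (pi2 y)) (pi1 (pi2 (pi2 y))) (pi2 (pi2 (pi2 y))) \<or>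
     pi1 y = 1 \<and> path_rule B P (pi1 (pi2 y)) (pi2 (pi2 y))"

text \<open>Facts occur only positively in the rules, and \<open>B\<close> bounds only existential
  quantifiers. This is what lets certificates be merged.\<close>

lemma rule_mono:
  assumes "rule B P y" "B \<le> B'" "\<And>y. P y \<Longrightarrow> P' y"
  shows "rule B' P' y"
proof -
  have B: "u < B \<longrightarrow> u < B'" for u using assms(2) by simp
  have P: "P y \<longrightarrow> P' y" for y using assms(3) by blast
  have "rule B P y \<longrightarrow> rule B' P' y"
    unfolding rule_def run_rule_def path_rule_def
    by (intro disj_mono conj_mono ex_mono all_mono imp_mono B P imp_refl)
  with assms(1) show ?thesis by blast
qed

section \<open>Soundness and completeness of certificates\<close>

lemma run_Mu_iff:
  "run (Mu p) x = Some v \<longleftrightarrow>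
     run p (pr x v) = Some 0 \<and> (\<forall>n<v. \<exists>u. run p (pr x n) = Some (Suc u))"
proof -
  let ?P = "\<lambda>v. run p (pr x v) = Some 0 \<and> (\<forall>n<v. \<exists>u. run p (pr x n) = Some (Suc u))"
  \<comment> \<open>Given two such values, the computation at the smaller one would return both zero
    and a successor; so the \<open>LEAST\<close> in \<open>run\<close> ranges over at most one
    number.\<close>
  have uniq: "v = w" if "?P v" "?P w" for v w
    using that by (metis Zero_not_Suc linorder_neqE_nat option.inject)
  show ?thesis
  proof (cases "\<exists>v. ?P v")
    case True
    then obtain w where w: "?P w" by blast
    then have "?P (LEAST w. ?P w)" by (rule LeastI)
    then have L: "(LEAST w. ?P w) = w" using uniq w by blast
    have "run (Mu p) x = Some w" using True by (simp only: run.simps Let_def if_True L)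
    then show ?thesis using w uniq by (metis option.inject)
  next
    case False
    then show ?thesis by (simp only: run.simps Let_def if_False) blast
  qed
qed

lemma run_rule_sound:
  assumes "run_rule B P (goedel p) x v"
    and P: "\<And>q x v. P (run_fact (goedel q) x v) \<Longrightarrow> run q x = Some v"
  shows "run p x = Some v"
proof (cases p)
  case (Tup q r)
  then have "run q x = Some (pi1 v)" "run r x = Some (pi2 v)"
    using assms by (auto simp: run_rule_def)
  then show ?thesis using Tup by simp
next
  case (Comp q r)
  have "(4 * n + 5) mod 4 = 1" "(4 * n + 1) div 4 = n" for n :: nat by presburger+
  then obtain u where "run r x = Some u" "run q u = Some v"
    using assms Comp by (auto simp: run_rule_def)
  then show ?thesis using Comp by simp
next
  case (PrimRec q r)
  have *: "(4 * n + 6) mod 4 = 2" "Suc (Suc (4 * n)) div 4 = n" "(4 * n + 2) div 4 = n" for n :: nat by presburger+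
  obtain y n where x: "x = pr y n" by (metis pi_pr(3))
  show ?thesis
  proof (cases n)
    case 0
    then have "run q y = Some v" using assms PrimRec * x by (auto simp: run_rule_def)
    then show ?thesis using PrimRec x 0 by simp
  next
    case (Suc k)
    then obtain w where "P (run_fact (goedel p) (pr y k) w)" "P (run_fact (goedel r) (pr y (pr k w)) v)"
      using assms(1) PrimRec * x by (auto simp: run_rule_def)
    then have "run p (pr y k) = Some w" "run r (pr y (pr k w)) = Some v" using P by blast+
    then show ?thesis using PrimRec x Suc by simp
  qed
next
  case (Mu q)
  have "(4 * n + 7) mod 4 = 3" "Suc (Suc (Suc (4 * n))) div 4 = n" "(4 * n + 3) div 4 = n" for n :: nat by presburger+
  then have "run q (pr x v) = Some 0 \<and> (\<forall>n<v. \<exists>u. run q (pr x n) = Some (Suc u))"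
    using assms Mu by (auto simp: run_rule_def)
  then show ?thesis unfolding Mu run_Mu_iff .
next
  case Zero
  then show ?thesis using assms(1) by (simp add: run_rule_def)
next
  case Succ
  then show ?thesis using assms(1) by (simp add: run_rule_def)
next
  case Proj1
  then show ?thesis using assms(1) by (simp add: run_rule_def flip: pi1_def)
next
  case Proj2
  then show ?thesis using assms(1) by (simp add: run_rule_def flip: pi2_def)
qed

lemma rule_sound:
  assumes "rule B P y" and P: "\<And>y. P y \<Longrightarrow> holds y"
  shows "holds y"
proof (cases "pi1 y = 0")
  case True
  obtain p where p: "goedel p = pi1 (pi2 y)" using goedel_surj by blast
  have "run p (pi1 (pi2 (pi2 y))) = Some (pi2 (pi2 (pi2 y)))"
  proof (rule run_rule_sound)
    show "run_rule B P (goedel p) (pi1 (pi2 (pi2 y))) (pi2 (pi2 (pi2 y)))"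
      using assms(1) True p by (simp add: rule_def)
    show "run q x = Some v" if "P (run_fact (goedel q) x v)" for q x v
      using P[OF that] by simp
  qed
  then show ?thesis using True by (simp add: holds_def flip: p)
next
  case False
  then have "path_rule B P (pi1 (pi2 y)) (pi2 (pi2 y))" using assms(1) by (simp add: rule_def)
  moreover have "o_step\<^sup>*\<^sup>* b c" if "o_step\<^sup>*\<^sup>* b d" "d = 2 ^ c \<and> 0 < c \<or> d = 3 * 5 ^ e \<and> phi e n = Some c"
    for b c d e n
    using that o_step_def by (metis rtranclp.rtrancl_into_rtrancl)
  ultimately have "o_step\<^sup>*\<^sup>* (pi1 (pi2 y)) (pi2 (pi2 y))"
    unfolding path_rule_def using P holds_path_fact holds_run_fact by (metis rtranclp.rtrancl_refl)
  then show ?thesis using False by (simp add: holds_def)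
qed

text \<open>\<open>D\<close> codes a finite set of entries \<open>pr k y\<close>, each a fact
  \<open>y\<close> with its rank \<open>k\<close>. Demanding a smaller rank for premises rules out
  circular derivations.\<close>

definition premise :: "nat \<Rightarrow> nat \<Rightarrow> nat \<Rightarrow> bool" where
  "premise D k y \<longleftrightarrow> (\<exists>k'<k. pr k' y \<in> set_decode D)"

definition valid :: "nat \<Rightarrow> nat \<Rightarrow> bool" where
  "valid B D \<longleftrightarrow> (\<forall>n<D. n \<in> set_decode D \<longrightarrow> rule B (premise D (pi1 n)) (pi2 n))"

text \<open>A certificate pairs a bound \<open>B\<close> with such a set \<open>D\<close>. Every
  rank occurring in \<open>D\<close> is below the number \<open>D\<close>, so this rank bound merely
  keeps the quantifier bounded.\<close>

definition proves :: "nat \<Rightarrow> nat \<Rightarrow> bool" where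
  "proves c y \<longleftrightarrow> valid (pi1 c) (pi2 c) \<and> premise (pi2 c) (pi2 c) y"

lemma dec_proves [cintro]:
  assumes "computable f" "computable g"
  shows "dec (\<lambda>x. proves (f x) (g x))"
proof -
  have "dec (\<lambda>z. proves (pi1 z) (pi2 z))"
    unfolding proves_def valid_def premise_def rule_def run_rule_def path_rule_def run_fact_def
      path_fact_def
    by (intro cintro)
  then show ?thesis by (rule dec_comp2) (rule assms)+
qed

lemma less_of_mem_set_decode: "n \<in> set_decode D \<Longrightarrow> n < D"
proof -
  assume "n \<in> set_decode D"
  then have "D div 2 ^ n \<noteq> 0" by (auto simp: set_decode_def intro: Nat.gr0I)
  then have "2 ^ n \<le> D" by (simp add: div_eq_0_iff)
  then show "n < D" using less_exp[of n] by linarith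
qed

lemma valid_iff: "valid B D \<longleftrightarrow> (\<forall>k y. pr k y \<in> set_decode D \<longrightarrow> rule B (premise D k) y)"
  unfolding valid_def using less_of_mem_set_decode by (metis pi_pr)

lemma proves_iff: "proves c y \<longleftrightarrow> valid (pi1 c) (pi2 c) \<and> (\<exists>k. pr k y \<in> set_decode (pi2 c))"
  unfolding proves_def premise_def
  using less_of_mem_set_decode le_prod_encode_1 by (meson le_less_trans)

lemma proves_sound:
  assumes "proves c y" shows "holds y"
proof -
  have "holds y" if "pr k y \<in> set_decode (pi2 c)" for k y
    using that
  proof (induction k arbitrary: y rule: less_induct)
    case (less k)
    then have "rule (pi1 c) (premise (pi2 c) k) y"
      using assms unfolding proves_iff valid_iff by blast
    then show ?case by (rule rule_sound) (use less.IH in \<open>auto simp: premise_def\<close>)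
  qed
  then show ?thesis using assms unfolding proves_iff by blast
qed

lemma premise_mono: "set_decode D \<subseteq> set_decode D' \<Longrightarrow> premise D k y \<Longrightarrow> premise D' k y"
  unfolding premise_def by blast

lemma proves_common:
  assumes "finite F" "\<And>y. y \<in> F \<Longrightarrow> \<exists>c. proves c y"
  shows "\<exists>c. valid (pi1 c) (pi2 c) \<and> (\<forall>y\<in>F. proves c y)"
  using assms
proof (induction F)
  case empty
  have "valid 0 0" by (simp add: valid_def)
  then show ?case by (metis empty_iff pi_pr(1,2))
next
  case (insert y F)
  obtain c where c: "valid (pi1 c) (pi2 c)" "\<forall>y\<in>F. proves c y" using insert by auto
  obtain c' where c': "proves c' y" using insert.prems by blast
  let ?D = "set_encode (set_decode (pi2 c) \<union> set_decode (pi2 c'))"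
  let ?B = "max (pi1 c) (pi1 c')"
  have D: "set_decode ?D = set_decode (pi2 c) \<union> set_decode (pi2 c')" by simp
  have "valid ?B ?D"
    unfolding valid_iff D
  proof (intro allI impI)
    fix k y assume "pr k y \<in> set_decode (pi2 c) \<union> set_decode (pi2 c')"
    then consider "rule (pi1 c) (premise (pi2 c) k) y" | "rule (pi1 c') (premise (pi2 c') k) y"
      using c(1) c' unfolding valid_iff proves_iff by blast
    then show "rule ?B (premise ?D k) y"
      by cases (erule rule_mono, simp, rule premise_mono, auto simp: D)+
  qed
  then have "valid (pi1 (pr ?B ?D)) (pi2 (pr ?B ?D)) \<and> (\<forall>y\<in>insert y F. proves (pr ?B ?D) y)"
    using c c' D unfolding proves_iff by auto
  then show ?case by blast
qed

lemma proves_rule: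
  assumes "finite F" "\<And>y. y \<in> F \<Longrightarrow> \<exists>c. proves c y" "rule B (\<lambda>y. y \<in> F) y"
  shows "\<exists>c. proves c y"
proof -
  obtain c where c: "valid (pi1 c) (pi2 c)" "\<forall>y\<in>F. proves c y"
    using proves_common[OF assms(1,2)] by blast
  \<comment> \<open>\<open>pi2 c\<close> exceeds all ranks occurring in \<open>c\<close>, so it can
    serve as the rank of the new fact.\<close>
  let ?D = "set_encode (insert (pr (pi2 c) y) (set_decode (pi2 c)))"
  let ?B = "max B (pi1 c)"
  have D: "set_decode ?D = insert (pr (pi2 c) y) (set_decode (pi2 c))" by simp
  have mono: "premise (pi2 c) k z \<Longrightarrow> premise ?D k z" for k z
    by (rule premise_mono) (auto simp: D)
  have "valid ?B ?D"
    unfolding valid_iff D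
  proof (intro allI impI)
    fix k z assume "pr k z \<in> insert (pr (pi2 c) y) (set_decode (pi2 c))"
    then consider "k = pi2 c" "z = y" | "pr k z \<in> set_decode (pi2 c)" by auto
    then show "rule ?B (premise ?D k) z"
    proof cases
      case 1
      show ?thesis unfolding 1
        by (rule rule_mono[OF assms(3)]) (use c(2) mono in \<open>auto simp: proves_def\<close>)
    next
      case 2
      then have "rule (pi1 c) (premise (pi2 c) k) z" using c(1) by (auto simp: valid_iff)
      then show ?thesis by (rule rule_mono) (auto simp: mono)
    qed
  qed
  then have "proves (pr ?B ?D) y" using D by (auto simp: proves_iff)
  then show ?thesis by blast
qed

lemma proves_run:
  "run p x = Some v \<Longrightarrow> \<exists>c. proves c (run_fact (goedel p) x v)"
proof (induction p arbitrary: x v)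
  case Zero
  show ?case
    by (rule proves_rule[of "{}" 0])
      (use Zero in \<open>auto simp: rule_def run_fact_def run_rule_def\<close>)
next
  case Succ
  show ?case
    by (rule proves_rule[of "{}" 0])
      (use Succ in \<open>auto simp: rule_def run_fact_def run_rule_def\<close>)
next
  case Proj1
  show ?case
    by (rule proves_rule[of "{}" 0])
      (use Proj1 in \<open>auto simp: rule_def run_fact_def run_rule_def pi1_def\<close>)
next
  case Proj2
  show ?case
    by (rule proves_rule[of "{}" 0])
      (use Proj2 in \<open>auto simp: rule_def run_fact_def run_rule_def pi2_def\<close>)
next
  case (Tup p q)
  obtain u w where v: "run p x = Some u" "run q x = Some w" "v = pr u w"
    using Tup.prems by (auto simp: bind_eq_Some_conv)
  show ?case
    by (rule proves_rule[of "{run_fact (goedel p) x u, run_fact (goedel q) x w}" 0])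
      (use v Tup.IH in \<open>auto simp: rule_def run_rule_def run_fact_def\<close>)
next
  case (Comp p q)
  obtain u where v: "run q x = Some u" "run p u = Some v"
    using Comp.prems by (auto simp: bind_eq_Some_conv)
  have *: "(4 * n + 5) mod 4 = 1" "Suc (4 * n) div 4 = n" for n :: nat by presburger+
  show ?case
    by (rule proves_rule[of "{run_fact (goedel q) x u, run_fact (goedel p) u v}" "Suc u"])
      (use v Comp.IH in \<open>auto simp: rule_def run_rule_def run_fact_def *\<close>)
next
  case (PrimRec p q)
  have *: "(4 * n + 6) mod 4 = 2" "Suc (Suc (4 * n)) div 4 = n" "(4 * n + 2) div 4 = n" for n :: nat by presburger+
  obtain y n where x: "x = pr y n" by (metis pi_pr(3))
  have "\<exists>c. proves c (run_fact (goedel (PrimRec p q)) (pr y n) v)"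
    if "run (PrimRec p q) (pr y n) = Some v" for n v
    using that
  proof (induction n arbitrary: v)
    case 0
    then have p: "run p y = Some v" by simp
    show ?case
      by (rule proves_rule[of "{run_fact (goedel p) y v}" 0])
        (use p PrimRec.IH in \<open>auto simp: rule_def run_rule_def run_fact_def *\<close>)
  next
    case (Suc n)
    obtain w where w: "run (PrimRec p q) (pr y n) = Some w" "run q (pr y (pr n w)) = Some v"
      using Suc.prems by (auto simp: bind_eq_Some_conv)
    show ?case
      by (rule proves_rule[of "{run_fact (goedel (PrimRec p q)) (pr y n) w,
              run_fact (goedel q) (pr y (pr n w)) v}" "Suc w"])
        (use w Suc.IH PrimRec.IH in \<open>auto simp: rule_def run_rule_def run_fact_def * simp del: run.simps\<close>)
  qed
  then show ?case using PrimRec.prems x by blast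
next
  case (Mu p)
  have *: "(4 * n + 7) mod 4 = 3" "Suc (Suc (Suc (4 * n))) div 4 = n" "(4 * n + 3) div 4 = n" for n :: nat by presburger+
  have 0: "run p (pr x v) = Some 0" using Mu.prems unfolding run_Mu_iff by blast
  have "\<forall>n. \<exists>u. n < v \<longrightarrow> run p (pr x n) = Some (Suc u)" using Mu.prems unfolding run_Mu_iff by blast
  then obtain k where k: "\<And>n. n < v \<Longrightarrow> run p (pr x n) = Some (Suc (k n))" by metis
  let ?F = "insert (run_fact (goedel p) (pr x v) 0)
     ((\<lambda>n. run_fact (goedel p) (pr x n) (Suc (k n))) ` {..<v})"
  show ?case
  proof (rule proves_rule[of ?F "Suc (sum k {..<v})"])
    show "\<exists>c. proves c y" if "y \<in> ?F" for y using that 0 k Mu.IH by blast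
    have "k n < Suc (sum k {..<v})" if "n < v" for n
      using that by (simp add: less_Suc_eq_le member_le_sum)
    then show "rule (Suc (sum k {..<v})) (\<lambda>y. y \<in> ?F) (run_fact (goedel (Mu p)) x v)"
      unfolding rule_def run_fact_def[of "goedel (Mu p)"] run_rule_def
      by (simp add: *) blast
  qed simp
qed

lemma proves_path:
  assumes "o_step\<^sup>*\<^sup>* b c" shows "\<exists>k. proves k (path_fact b c)"
  using assms
proof (induction rule: rtranclp_induct)
  case base
  show ?case
    by (rule proves_rule[of "{}" 0]) (auto simp: rule_def path_rule_def path_fact_def)
next
  case (step d c)
  from \<open>o_step d c\<close> consider "d = 2 ^ c" "0 < c" | e n where "d = 3 * 5 ^ e" "phi e n = Some c"
    unfolding o_step_def by blast
  then show ?case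
  proof cases
    case 1
    show ?thesis
      by (rule proves_rule[of "{path_fact b d}" "Suc d"])
        (use 1 step.IH in \<open>auto simp: rule_def path_rule_def path_fact_def\<close>)
  next
    case 2
    obtain p where "goedel p = e" using goedel_surj by blast
    then have c: "\<exists>k. proves k (run_fact e n c)" using proves_run 2 by auto
    let ?F = "{path_fact b d, run_fact e n c}"
    have "d < Suc (d + e + n)" "e < Suc (d + e + n)" "n < Suc (d + e + n)" by auto
    then have "path_rule (Suc (d + e + n)) (\<lambda>y. y \<in> ?F) b c"
      unfolding path_rule_def using 2(1) by blast
    then have "rule (Suc (d + e + n)) (\<lambda>y. y \<in> ?F) (path_fact b c)"
      by (simp add: rule_def path_fact_def)
    then show ?thesis using proves_rule[of ?F] c step.IH by blast
  qed
qed

text \<open>The shape assumption excludes tags other than 0 and 1: \<open>holds\<close> reads those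
  as path facts, but \<open>rule\<close> derives none of them.\<close>

lemma holds_imp_proves:
  assumes "finite F" "\<And>y. y \<in> F \<Longrightarrow> (\<exists>e x v. y = run_fact e x v) \<or> (\<exists>b c. y = path_fact b c)"
    and "\<And>y. y \<in> F \<Longrightarrow> holds y"
  shows "\<exists>c. \<forall>y\<in>F. proves c y"
proof -
  have "\<exists>c. proves c y" if "y \<in> F" for y
    using assms(2,3)[OF that] proves_path proves_run goedel_surj
    by (metis holds_path_fact holds_run_fact phi_goedel)
  then show ?thesis using proves_common[OF assms(1)] by blast
qed

section \<open>Trajectories of candidate approximations\<close>

lemma KO_o_step:
  assumes "KO d" "o_step d c" shows "KO c \<and> KO_less c d"
  using assms(1)
proof (cases rule: KO.cases)
  case KO_one
  have "(2::nat) ^ c \<noteq> 1" if "0 < c" using that by simp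
  then show ?thesis using assms(2) KO_one lim_neq_one unfolding o_step_def by metis
next
  case (KO_succ b)
  then have "b = c" using assms(2) two_power_neq_lim unfolding o_step_def
    by (metis numeral_eq_iff one_less_numeral_iff power_inject_exp semiring_norm(76))
  then show ?thesis using KO_succ KO_less_succ by simp
next
  case (KO_lim e h)
  then have "\<exists>n. c = h n"
    using assms(2) two_power_neq_lim lim_inj unfolding o_step_def by (metis option.inject)
  then show ?thesis using KO_lim KO_less_lim by blast
qed

lemma KO_le_trans: "KO_le b c \<Longrightarrow> KO_le c d \<Longrightarrow> KO_le b d"
  unfolding KO_le_def using KO_less_trans by blast

lemma o_path_KO_le:
  assumes "o_step\<^sup>*\<^sup>* b c" "KO b" shows "KO c \<and> KO_le c b"
  using assms
proof (induction rule: rtranclp_induct)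
  case (step d c)
  then show ?case using KO_o_step[of d c] KO_le_trans unfolding KO_le_def by blast
qed (simp add: KO_le_def)

lemma KO_less_o_path: "KO a \<Longrightarrow> True" "KO_less c b \<Longrightarrow> o_step\<^sup>*\<^sup>* b c"
proof (induction rule: KO_KO_less.inducts)
  case (KO_less_succ a)
  then have "o_step (2 ^ a) a" using KO_pos by (simp add: o_step_def)
  then show ?case by blast
next
  case (KO_less_lim e h k)
  then have "o_step (3 * 5 ^ e) (h k)" unfolding o_step_def by blast
  then show ?case by blast
qed auto

lemma KO_le_o_path: "KO_le c b \<Longrightarrow> o_step\<^sup>*\<^sup>* b c"
  unfolding KO_le_def using KO_less_o_path(2) by blast

text \<open>A positive ordinal leaves room for one change of mind, paid for by dropping from
  \<open>a\<close> to \<open>b\<close>.\<close>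

lemma KO_ex_less:
  assumes "KO a" "0 < KO_ord a" shows "\<exists>b. KO b \<and> KO_less b a"
  using assms(1)
proof (cases rule: KO.cases)
  case KO_one
  then show ?thesis using assms(2) KO_ord_one by (metis less_irrefl)
next
  case (KO_succ b)
  then show ?thesis using KO_less_succ by blast
next
  case (KO_lim e h)
  then show ?thesis using KO_less_lim by blast
qed

lemma KO_less_imp_neq: "KO_less b a \<Longrightarrow> b \<noteq> a"
  using KO_ord_less(2) by (metis less_irrefl)

text \<open>The ordinals attain a least value; after that a strict step of \<open>KO_less\<close>
  would lower the ordinal further, so the notations themselves stay equal, not just their
  ordinals.\<close>

lemma KO_le_decreasing_eventually_const:
  assumes "\<And>s. KO_le (g (Suc s)) (g s)"
  shows "\<exists>N. \<forall>s\<ge>N. g s = g N"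
proof -
  have le: "KO_ord (g (Suc s)) \<le> KO_ord (g s)" for s
    using assms[of s] KO_ord_less(2) unfolding KO_le_def by (metis order.refl less_imp_le)
  then have anti: "KO_ord (g t) \<le> KO_ord (g s)" if "s \<le> t" for s t
    using that by (rule lift_Suc_antimono_le)
  let ?P = "\<lambda>\<alpha>. \<exists>s. \<alpha> = KO_ord (g s)"
  have "?P (LEAST \<alpha>. ?P \<alpha>)" by (rule LeastI) blast
  then obtain N where N: "(LEAST \<alpha>. ?P \<alpha>) = KO_ord (g N)" by blast
  have min: "KO_ord (g N) \<le> KO_ord (g s)" for s
    unfolding N[symmetric] by (rule Least_le) blast
  have "g s = g N" if "N \<le> s" for s
    using that
  proof (induction s rule: dec_induct)
    case (step s)
    have "\<not> KO_less (g (Suc s)) (g s)"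
      using KO_ord_less(2)[of "g (Suc s)" "g s"] min[of "Suc s"] anti[OF step.hyps(1)] by auto
    then show ?case using assms[of s] step.IH unfolding KO_le_def by auto
  qed simp
  then show ?thesis by blast
qed

lemma decidable_in_Sigma_inv:
  assumes "KO a" "0 < KO_ord a" "dec (\<lambda>z. z \<in> A)"
  shows "A \<in> Sigma_inv a"
proof -
  obtain b where b: "KO b" "KO_less b a" using KO_ex_less assms(1,2) by blast
  define f :: "nat \<Rightarrow> nat \<Rightarrow> nat" where "f z t = of_bool (0 < t \<and> z \<in> A)" for z t
  define \<gamma> :: "nat \<Rightarrow> nat \<Rightarrow> nat" where "\<gamma> z t = (if 0 < t \<and> z \<in> A then b else a)" for z t
  have A: "dec (\<lambda>x. pi1 x \<in> A)"
    using assms(3) computable_comp[OF _ computable_pi1[OF computable_id], of "\<lambda>z. of_bool (z \<in> A)"]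
    unfolding dec_def by simp
  have "computable2 f" "computable2 \<gamma>"
    unfolding computable2_iff f_def \<gamma>_def by (intro cintro A)+
  moreover have "(\<lambda>t. f z t) \<longlonglongrightarrow> of_bool (z \<in> A)" for z
    by (rule tendsto_eventually) (auto simp: f_def eventually_sequentially intro: exI[of _ 1])
  moreover have "f z 0 = 0 \<and> \<gamma> z 0 = a \<and> (\<forall>t. KO_le (\<gamma> z (Suc t)) (\<gamma> z t) \<and> KO_le (\<gamma> z t) a \<and>
            (f z (Suc t) \<noteq> f z t \<longrightarrow> \<gamma> z (Suc t) \<noteq> \<gamma> z t))" for z
    using b assms(1) KO_less_imp_neq[OF b(2)] by (auto simp: f_def \<gamma>_def KO_le_def)
  ultimately show ?thesis unfolding Sigma_inv_def by blast
qed

text \<open>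
  A trajectory follows a candidate \<open>(\<phi>\<^sub>i, \<phi>\<^sub>j)\<close> for \<open>(f, \<gamma>)\<close> at the argument \<open>w\<close>, moving on only when the next
  values come with a certificate of convergence and of descent in \<open>\<O>\<close>. Its state consists of the
  position \<open>t\<close> in the candidate, the value and the notation. Stage \<open>s\<close> tries the certificate \<^term>\<open>pi1 s\<close>, and
  so every certificate is tried infinitely often.
\<close>

definition advances :: "nat \<Rightarrow> nat \<Rightarrow> nat \<Rightarrow> nat \<Rightarrow> nat \<Rightarrow> nat \<Rightarrow> nat \<Rightarrow> nat \<Rightarrow> bool" where
  "advances i j w t u b u' c \<longleftrightarrow>
     proves (pi2 c) (run_fact i (pr w (Suc t)) u') \<and>
     proves (pi2 c) (run_fact j (pr w (Suc t)) (pi1 c)) \<and>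
     proves (pi2 c) (path_fact b (pi1 c)) \<and> (u' \<noteq> u \<longrightarrow> pi1 c \<noteq> b)"

definition traj :: "nat \<Rightarrow> nat \<Rightarrow> nat \<Rightarrow> nat \<Rightarrow> nat \<Rightarrow> nat" where
  "traj a i j w = rec_nat (pr 0 (pr 0 a))
     (\<lambda>s q. if advances i j w (pi1 q) (pi1 (pi2 q)) (pi2 (pi2 q)) (pi1 (pi1 s)) (pi2 (pi1 s))
            then pr (Suc (pi1 q)) (pr (pi1 (pi1 s)) (pi1 (pi2 (pi1 s)))) else q)"

abbreviation "tidx a i j w s \<equiv> pi1 (traj a i j w s)"
abbreviation "tval a i j w s \<equiv> pi1 (pi2 (traj a i j w s))"
abbreviation "tnot a i j w s \<equiv> pi2 (pi2 (traj a i j w s))"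

lemma computable_traj [cintro]:
  assumes "computable i" "computable j" "computable w" "computable s"
  shows "computable (\<lambda>x. traj a (i x) (j x) (w x) (s x))"
proof -
  have "computable (\<lambda>z. traj a (pi1 (pi1 z)) (pi2 (pi1 z)) (pi1 (pi2 z)) (pi2 (pi2 z)))"
    unfolding traj_def advances_def run_fact_def path_fact_def by (intro cintro)
  from computable_comp[OF this computable_pr[OF computable_pr[OF assms(1,2)] computable_pr[OF assms(3,4)]]]
  show ?thesis by simp
qed

lemma traj_0: "traj a i j w 0 = pr 0 (pr 0 a)"
  by (simp add: traj_def)

lemma traj_Suc:
  "traj a i j w (Suc s) =
     (if advances i j w (tidx a i j w s) (tval a i j w s) (tnot a i j w s) (pi1 (pi1 s)) (pi2 (pi1 s))
      then pr (Suc (tidx a i j w s)) (pr (pi1 (pi1 s)) (pi1 (pi2 (pi1 s)))) else traj a i j w s)"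
  by (simp add: traj_def)

text \<open>The candidate may be anything, even partial: every move carries a certified path in O,
  and \<open>advances\<close> refuses a change of value without a change of notation.\<close>

lemma traj_sound:
  assumes "KO a"
  shows "KO (tnot a i j w s) \<and> KO_le (tnot a i j w s) a"
    and "KO_le (tnot a i j w (Suc s)) (tnot a i j w s)"
    and "tval a i j w (Suc s) \<noteq> tval a i j w s \<Longrightarrow> tnot a i j w (Suc s) \<noteq> tnot a i j w s"
proof -
  have step: "KO (tnot a i j w (Suc s)) \<and> KO_le (tnot a i j w (Suc s)) (tnot a i j w s)"
    if "KO (tnot a i j w s)" for s
  proof -
    have "KO c \<and> KO_le c (tnot a i j w s)" if "proves k (path_fact (tnot a i j w s) c)" for k c
      using proves_sound[OF that] o_path_KO_le \<open>KO (tnot a i j w s)\<close> by simp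
    then show ?thesis using that by (auto simp: traj_Suc advances_def KO_le_def)
  qed
  show *: "KO (tnot a i j w s) \<and> KO_le (tnot a i j w s) a" for s
  proof (induction s)
    case 0
    then show ?case using assms by (simp add: traj_0 KO_le_def)
  next
    case (Suc s)
    then show ?case using step[of s] KO_le_trans by blast
  qed
  show "KO_le (tnot a i j w (Suc s)) (tnot a i j w s)" using step[of s] * by blast
  show "tval a i j w (Suc s) \<noteq> tval a i j w s \<Longrightarrow> tnot a i j w (Suc s) \<noteq> tnot a i j w s"
    by (auto simp: traj_Suc advances_def split: if_splits)
qed

lemma traj_eventually_const:
  assumes "KO a" shows "\<exists>N. \<forall>s\<ge>N. tval a i j w s = tval a i j w N"
proof -
  obtain N where N: "\<forall>s\<ge>N. tnot a i j w s = tnot a i j w N"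
    using KO_le_decreasing_eventually_const[of "tnot a i j w"] traj_sound(2)[OF assms] by blast
  have "tval a i j w s = tval a i j w N" if "N \<le> s" for s
    using that
  proof (induction s rule: dec_induct)
    case (step s)
    have "tnot a i j w (Suc s) = tnot a i j w s" using N step.hyps by (metis le_SucI)
    then show ?case using traj_sound(3)[OF assms] step.IH by metis
  qed simp
  then show ?thesis by blast
qed

text \<open>By soundness of certificates the state always agrees with the candidate at the current
  position. As every certificate recurs at late stages, the position is unbounded and the trajectory
  reaches the limit of the candidate.\<close>

lemma traj_complete:
  assumes i: "\<And>t. phi i (pr w t) = Some (f t)" and j: "\<And>t. phi j (pr w t) = Some (\<gamma> t)"
    and "f 0 = 0" "\<gamma> 0 = a" and le: "\<And>t. KO_le (\<gamma> (Suc t)) (\<gamma> t)"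
    and ch: "\<And>t. f (Suc t) \<noteq> f t \<Longrightarrow> \<gamma> (Suc t) \<noteq> \<gamma> t"
    and lim: "\<And>t. M \<le> t \<Longrightarrow> f t = l"
  shows "\<exists>N. \<forall>s\<ge>N. tval a i j w s = l"
proof -
  have st: "tval a i j w s = f (tidx a i j w s) \<and> tnot a i j w s = \<gamma> (tidx a i j w s)" for s
  proof (induction s)
    case 0
    then show ?case using assms(3,4) by (simp add: traj_0)
  next
    case (Suc s)
    have "u = f (Suc t) \<and> pi1 c = \<gamma> (Suc t)" if "advances i j w t v b u c" for t u v b c
      using that proves_sound[of _ "run_fact _ _ _"] i j unfolding advances_def by fastforce
    then show ?case using Suc by (auto simp: traj_Suc)
  qed
  have mono: "tidx a i j w s \<le> tidx a i j w t" if "s \<le> t" for s t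
    using that by (rule lift_Suc_mono_le[rotated]) (simp add: traj_Suc)
  have "\<exists>s. t \<le> tidx a i j w s" for t
  proof (induction t)
    case (Suc t)
    then obtain s where s: "t \<le> tidx a i j w s" by blast
    show ?case
    proof (rule ccontr)
      assume no: "\<nexists>s. Suc t \<le> tidx a i j w s"
      then have eq: "tidx a i j w r = t" if "s \<le> r" for r
        using s mono[OF that] by (meson le_antisym le_trans not_less_eq_eq)
      let ?F = "{run_fact i (pr w (Suc t)) (f (Suc t)), run_fact j (pr w (Suc t)) (\<gamma> (Suc t)),
          path_fact (\<gamma> t) (\<gamma> (Suc t))}"
      have "\<exists>c. \<forall>y\<in>?F. proves c y"
        by (rule holds_imp_proves) (use i j KO_le_o_path[OF le[of t]] in auto)
      then obtain c where c: "\<forall>y\<in>?F. proves c y" by blast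
      \<comment> \<open>The first component holds the next value, the next notation and the
        certificate, in the order in which \<open>traj\<close> reads them; the second pushes the
        stage up to at least \<open>s\<close>.\<close>
      define r where "r = pr (pr (f (Suc t)) (pr (\<gamma> (Suc t)) c)) s"
      have "s \<le> r" unfolding r_def by (rule le_prod_encode_2)
      then have "tidx a i j w r = t" using eq by blast
      then have "advances i j w (tidx a i j w r) (tval a i j w r) (tnot a i j w r)
          (pi1 (pi1 r)) (pi2 (pi1 r))"
        using c st[of r] ch by (simp add: advances_def r_def)
      then have "tidx a i j w (Suc r) = Suc t" using \<open>tidx a i j w r = t\<close> by (simp add: traj_Suc)
      then show False using no by (metis order_refl)
    qed
  qed simp
  then obtain N where N: "M \<le> tidx a i j w N" by blast
  have "tval a i j w s = l" if "N \<le> s" for s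
    using st[of s] lim[of "tidx a i j w s"] N mono[OF that] by linarith
  then show ?thesis by blast
qed

section \<open>The action of the requirements\<close>

definition sel :: "nat \<Rightarrow> nat \<Rightarrow> nat" where
  "sel d x = (if d = 0 then pi1 x else pi2 x)"

lemma sel_pr [simp]: "sel 0 (pr x y) = x" "sel (Suc 0) (pr x y) = y"
  by (simp_all add: sel_def)

lemma computable_sel [cintro]:
  "computable f \<Longrightarrow> computable g \<Longrightarrow> computable (\<lambda>x. sel (f x) (g x))"
  unfolding sel_def by (intro cintro)

text \<open>
  A stage \<open>t\<close> proposes, through \<^term>\<open>pi1 t\<close>, an action of the requirement \<^term>\<open>req t\<close>. The side \<open>d\<close> is \<open>0\<close> for \<open>R\<close>
  and \<open>1\<close> for \<open>S\<close>; \<^term>\<open>elt d r t\<close> is the claimed image of \<^term>\<open>point r t\<close> on side \<open>d\<close>.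
\<close>

definition req :: "nat \<Rightarrow> nat" where "req t = pi1 (pi1 t)"
definition point :: "nat \<Rightarrow> nat \<Rightarrow> nat" where "point r t = sel r (pi1 (pi2 (pi1 t)))"
definition elt :: "nat \<Rightarrow> nat \<Rightarrow> nat \<Rightarrow> nat" where "elt d r t = sel r (sel d (pi1 (pi2 (pi2 (pi1 t)))))"
definition crt :: "nat \<Rightarrow> nat" where "crt t = pi2 (pi2 (pi2 (pi1 t)))"

definition touches :: "nat \<Rightarrow> nat \<Rightarrow> nat \<Rightarrow> bool" where
  "touches d t z \<longleftrightarrow> elt d 0 t div 2 = z \<or> elt d 1 t div 2 = z"

text \<open>
  Only finitely many pairs are forbidden to a requirement \<open>e\<close>, while \<open>(k, 0), \<dots>, (k, 2k)\<close> are open to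
  at most \<open>k\<close> requirements, each touching at most two of them.
\<close>

definition may_touch :: "nat \<Rightarrow> nat \<Rightarrow> bool" where
  "may_touch e z \<longleftrightarrow> e < pi1 z \<or> 2 * e < pi2 z"

text \<open>\<open>D\<close> codes the set of stages that have acted so far, so that actions can be
  defined by primitive recursion on a finite history.\<close>

definition eligible :: "nat \<Rightarrow> nat \<Rightarrow> bool" where
  "eligible t D \<longleftrightarrow>
     (\<forall>t'<t. t' \<in> set_decode D \<longrightarrow> req t' \<noteq> req t) \<and>
     (\<forall>d<2. elt d 0 t div 2 \<noteq> elt d 1 t div 2) \<and>
     (\<forall>d<2. \<forall>r<2. proves (crt t) (run_fact (sel d (req t)) (point r t) (elt d r t)) \<and>
        may_touch (req t) (elt d r t div 2) \<and>
        (\<forall>t'<t. t' \<in> set_decode D \<longrightarrow> \<not> touches d t' (elt d r t div 2)))"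

definition hist :: "nat \<Rightarrow> nat" where
  "hist = rec_nat 0 (\<lambda>t D. if eligible t D then 2 ^ t + D else D)"

definition act :: "nat \<Rightarrow> bool" where
  "act t \<longleftrightarrow> eligible t (hist t)"

lemma computable_elt [cintro]:
  "computable d \<Longrightarrow> computable r \<Longrightarrow> computable t \<Longrightarrow> computable (\<lambda>x. elt (d x) (r x) (t x))"
  unfolding elt_def by (intro cintro)

lemma dec_touches [cintro]:
  "computable d \<Longrightarrow> computable t \<Longrightarrow> computable z \<Longrightarrow> dec (\<lambda>x. touches (d x) (t x) (z x))"
  unfolding touches_def by (intro cintro)

lemma dec_act [cintro]:
  assumes "computable t" shows "dec (\<lambda>x. act (t x))"
proof -
  have el: "dec (\<lambda>z. eligible (pi1 z) (pi2 z))"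
    unfolding eligible_def req_def point_def crt_def may_touch_def run_fact_def by (intro cintro)
  then have "dec (\<lambda>z. eligible (pi1 (pi2 z)) (pi2 (pi2 z)))"
    by (rule dec_comp2) (intro cintro)+
  then have "computable hist" unfolding hist_def by (intro cintro)
  then have "computable (\<lambda>x. hist (t x))" using assms by (rule computable_comp)
  then show ?thesis unfolding act_def using assms by (intro dec_comp2[OF el])
qed

lemma set_decode_hist: "set_decode (hist t) = {t'. t' < t \<and> act t'}"
proof (induction t)
  case 0
  show ?case by (simp add: hist_def)
next
  case (Suc t)
  have "hist (Suc t) = (if act t then 2 ^ t + hist t else hist t)" by (simp add: hist_def act_def)
  moreover have "t \<notin> set_decode (hist t)" using Suc by simp
  ultimately show ?case
    using Suc by (auto simp: set_decode_plus_power_2 less_Suc_eq)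
qed

lemma act_iff:
  "act t \<longleftrightarrow>
     (\<forall>t'<t. act t' \<longrightarrow> req t' \<noteq> req t) \<and>
     (\<forall>d<2. elt d 0 t div 2 \<noteq> elt d 1 t div 2) \<and>
     (\<forall>d<2. \<forall>r<2. proves (crt t) (run_fact (sel d (req t)) (point r t) (elt d r t)) \<and>
        may_touch (req t) (elt d r t div 2) \<and>
        (\<forall>t'<t. act t' \<longrightarrow> \<not> touches d t' (elt d r t div 2)))"
  by (subst act_def, unfold eligible_def set_decode_hist) blast

lemma act_req_inj: "act t \<Longrightarrow> act t' \<Longrightarrow> req t = req t' \<Longrightarrow> t = t'"
  by (metis act_iff linorder_neqE_nat)

section \<open>Touched pairs and the stages at which they freeze\<close>

definition touched :: "nat \<Rightarrow> nat \<Rightarrow> bool" where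
  "touched d z \<longleftrightarrow> (\<exists>t. act t \<and> touches d t z)"

definition touch_time :: "nat \<Rightarrow> nat \<Rightarrow> nat" where
  "touch_time d z = (LEAST t. act t \<and> touches d t z)"

text \<open>The stage up to which the trajectory of the pair has been followed by stage
  \<open>s\<close>. The search stops at \<open>s\<close>, whereas \<open>touch_time\<close> searches
  without bound.\<close>

definition freeze :: "nat \<Rightarrow> nat \<Rightarrow> nat \<Rightarrow> nat" where
  "freeze d z s = (LEAST t. s \<le> t \<or> act t \<and> touches d t z)"

lemma computable_freeze [cintro]:
  assumes "computable d" "computable z" "computable s"
  shows "computable (\<lambda>x. freeze (d x) (z x) (s x))"
proof -
  have "computable (\<lambda>x. freeze (pi1 x) (pi1 (pi2 x)) (pi2 (pi2 x)))"
    unfolding freeze_def by (intro cintro)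
  then show ?thesis by (rule computable_comp3) (rule assms)+
qed

lemma touch_time_touches: "touched d z \<Longrightarrow> act (touch_time d z) \<and> touches d (touch_time d z) z"
  unfolding touched_def touch_time_def by (rule LeastI_ex)

lemma freeze_eq: "freeze d z s = (if touched d z then min s (touch_time d z) else s)"
proof (cases "touched d z")
  case True
  have "freeze d z s = min s (touch_time d z)"
    unfolding freeze_def
  proof (rule Least_equality)
    show "s \<le> min s (touch_time d z) \<or>
        act (min s (touch_time d z)) \<and> touches d (min s (touch_time d z)) z"
      using touch_time_touches[OF True] by (simp add: min_def)
    fix t assume "s \<le> t \<or> act t \<and> touches d t z"
    then show "min s (touch_time d z) \<le> t"
      unfolding touch_time_def by (auto simp: min_le_iff_disj intro: Least_le)
  qed
  then show ?thesis using True by simp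
next
  case False
  then have "freeze d z s = s"
    unfolding freeze_def touched_def by (intro Least_equality) auto
  then show ?thesis using False by simp
qed

lemma act_touch_time:
  assumes "act t" "d < 2" "r < 2"
  shows "touched d (elt d r t div 2)" "touch_time d (elt d r t div 2) = t"
proof -
  have "r = 0 \<or> r = 1" using assms(3) by auto
  then have t: "touches d t (elt d r t div 2)" by (auto simp: touches_def)
  then show "touched d (elt d r t div 2)" using assms(1) touched_def by blast
  show "touch_time d (elt d r t div 2) = t"
    unfolding touch_time_def
  proof (rule Least_equality)
    show "act t \<and> touches d t (elt d r t div 2)" using t assms(1) by blast
    show "t \<le> t'" if "act t' \<and> touches d t' (elt d r t div 2)" for t'
      using that assms unfolding act_iff[of t] by (meson not_le)
  qed
qed

lemma ex_untouched:
  assumes "d < 2" shows "\<exists>m. \<not> touched d (pr k m)"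
proof (rule ccontr)
  assume "\<nexists>m. \<not> touched d (pr k m)"
  then have "\<forall>m. \<exists>t r. act t \<and> r < 2 \<and> elt d r t div 2 = pr k m"
    unfolding touched_def touches_def by (metis one_less_numeral_iff pos2 semiring_norm(76))
  then obtain t r where tr: "\<And>m. act (t m)" "\<And>m. r m < 2" "\<And>m. elt d (r m) (t m) div 2 = pr k m"
    by metis
  \<comment> \<open>For \<open>m\<close> up to \<open>2 * k\<close>, either alternative of
    \<open>may_touch\<close> forces the requirement below \<open>k\<close>.\<close>
  have "req (t m) < k" if "m \<le> 2 * k" for m
  proof -
    have "may_touch (req (t m)) (pr k m)" using tr[of m] assms act_iff[of "t m"] by metis
    then show ?thesis using that by (auto simp: may_touch_def)
  qed
  then have "(\<lambda>m. (req (t m), r m)) ` {..2 * k} \<subseteq> {..<k} \<times> {..<2}" using tr(2) by auto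
  moreover have "inj_on (\<lambda>m. (req (t m), r m)) {..2 * k}"
  proof (rule inj_onI)
    fix m n assume "(req (t m), r m) = (req (t n), r n)"
    then have "t m = t n" "r m = r n" using act_req_inj tr(1) by auto
    then have "pr k m = pr k n" using tr(3) by metis
    then show "m = n" by simp
  qed
  \<comment> \<open>This says that \<open>2 * k + 1\<close> pairs are served by \<open>k\<close>
    requirements with two elements each.\<close>
  ultimately have "card {..2 * k} \<le> card ({..<k} \<times> {..<2::nat})"
    by (intro card_inj_on_le) auto
  then show False by simp
qed

section \<open>The two relations\<close>

text \<open>The candidate sits in \<open>pi1 z\<close>; \<open>pi2 z\<close> is padding, which gives
  each candidate infinitely many pairs.\<close>

definition twin_traj :: "nat \<Rightarrow> nat \<Rightarrow> nat \<Rightarrow> nat" where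
  "twin_traj a z s = traj a (pi1 (pi1 z)) (pi2 (pi1 z)) (pr (2 * z) (2 * z + 1)) s"

definition twins :: "nat \<Rightarrow> nat \<Rightarrow> nat \<Rightarrow> bool" where
  "twins a z s \<longleftrightarrow> pi1 (pi2 (twin_traj a z s)) = 1"

definition twins_lim :: "nat \<Rightarrow> nat \<Rightarrow> bool" where
  "twins_lim a z \<longleftrightarrow> (\<exists>N. \<forall>s\<ge>N. twins a z s)"

text \<open>
  The class of \<open>x\<close> when its pair is touched at stage \<open>t\<close>: \<^term>\<open>elt d 0 t\<close> is sent to \<open>0\<close>, and \<^term>\<open>elt d 1 t\<close> is
  sent to \<open>d\<close>, which is \<open>0\<close> for \<open>R\<close> and \<open>1\<close> for \<open>S\<close>. The twins of these elements follow or avoid them.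
\<close>

definition cls :: "nat \<Rightarrow> nat \<Rightarrow> nat \<Rightarrow> nat \<Rightarrow> nat" where
  "cls a d t x =
     (if x = elt d 0 t then 0 else if x = elt d 1 t then d
      else if x div 2 = elt d 0 t div 2 then (if twins a (x div 2) t then 0 else 1)
      else if twins a (x div 2) t then d else 1 - d)"

text \<open>The tags 0, 1, 2 separate elements of touched pairs, of untouched pairs with equivalent
  twins, and isolated elements.\<close>

definition key :: "nat \<Rightarrow> nat \<Rightarrow> nat \<Rightarrow> nat \<times> nat" where
  "key a d x =
     (if touched d (x div 2) then (0, cls a d (touch_time d (x div 2)) x)
      else if twins_lim a (x div 2) then (1, x div 2) else (2, x))"

definition rel :: "nat \<Rightarrow> nat \<Rightarrow> nat rel" where
  "rel a d = {(x, y). key a d x = key a d y}"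

lemma equiv_rel: "equiv UNIV (rel a d)"
  by (auto simp: rel_def equiv_def refl_on_def sym_def trans_def)

lemma cls_less: "d < 2 \<Longrightarrow> cls a d t x < 2"
  by (auto simp: cls_def)

text \<open>Exactly one of the twins is named by the action; the other joins its class or takes the
  opposite one, according to the trajectory at stage \<open>t\<close>. So freezing keeps the current
  verdict.\<close>

lemma cls_twin:
  assumes "d < 2" "act t" "touches d t (x div 2)" "x \<noteq> y" "x div 2 = y div 2"
  shows "cls a d t x = cls a d t y \<longleftrightarrow> twins a (x div 2) t"
proof -
  have ne: "elt d 0 t div 2 \<noteq> elt d 1 t div 2" using assms(1,2) act_iff[of t] by blast
  have two: "x = p \<or> y = p" if "p div 2 = x div 2" for p :: nat
  proof -
    have "x mod 2 \<noteq> y mod 2" using assms(4,5) by (metis div_mult_mod_eq)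
    then have "p mod 2 = x mod 2 \<or> p mod 2 = y mod 2" by (metis not_mod_2_eq_0_eq_1)
    then show ?thesis using that assms(5) by (metis div_mult_mod_eq)
  qed
  from assms(3) consider "elt d 0 t div 2 = x div 2" | "elt d 1 t div 2 = x div 2"
    unfolding touches_def by blast
  then show ?thesis
  proof cases
    case 1
    have cls: "cls a d t v = (if v = elt d 0 t \<or> twins a (x div 2) t then 0 else 1)"
      if "v div 2 = x div 2" for v
      using that 1 ne by (auto simp: cls_def)
    show ?thesis
      unfolding cls[OF refl] cls[OF assms(5)[symmetric]] using two[OF 1] assms(4) by auto
  next
    case 2
    have cls: "cls a d t v = (if v = elt d 1 t \<or> twins a (x div 2) t then d else 1 - d)"
      if "v div 2 = x div 2" for v
      using that 2 ne by (auto simp: cls_def)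
    have "1 - d \<noteq> d" by presburger
    then show ?thesis
      unfolding cls[OF refl] cls[OF assms(5)[symmetric]] using two[OF 2] assms(4) by auto
  qed
qed

section \<open>The relations are in Sigma but not in Pi\<close>

lemma twin_traj_sound:
  assumes "KO a"
  shows "KO_le (pi2 (pi2 (twin_traj a z s))) a"
    and "KO_le (pi2 (pi2 (twin_traj a z (Suc s)))) (pi2 (pi2 (twin_traj a z s)))"
    and "twins a z (Suc s) \<noteq> twins a z s \<Longrightarrow>
      pi2 (pi2 (twin_traj a z (Suc s))) \<noteq> pi2 (pi2 (twin_traj a z s))"
    and "KO (pi2 (pi2 (twin_traj a z s)))"
  unfolding twins_def twin_traj_def using traj_sound[OF assms] by metis+

lemma twins_eventually:
  assumes "KO a" shows "\<exists>N. \<forall>s\<ge>N. twins a z s = twins_lim a z"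
proof -
  obtain N where N: "\<forall>s\<ge>N. twins a z s = twins a z N"
    unfolding twins_def twin_traj_def
    using traj_eventually_const[OF assms, of "pi1 (pi1 z)" "pi2 (pi1 z)" "pr (2 * z) (2 * z + 1)"]
    by metis
  then have "twins_lim a z = twins a z N" unfolding twins_lim_def by (metis nle_le)
  then show ?thesis using N by blast
qed

lemma computable_twin_traj [cintro]:
  "computable z \<Longrightarrow> computable s \<Longrightarrow> computable (\<lambda>x. twin_traj a (z x) (s x))"
  unfolding twin_traj_def by (intro cintro)

lemma dec_twins [cintro]:
  "computable z \<Longrightarrow> computable s \<Longrightarrow> dec (\<lambda>x. twins a (z x) (s x))"
  unfolding twins_def by (intro cintro)

lemma computable_cls [cintro]:
  "computable t \<Longrightarrow> computable f \<Longrightarrow> computable (\<lambda>x. cls a d (t x) (f x))"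
  unfolding cls_def by (intro cintro)

text \<open>\<open>freeze d z s < s\<close> says that the pair was touched before stage
  \<open>s\<close>. The diagonal waits for \<open>0 < s\<close> because approximations must start at
  0.\<close>

definition approx :: "nat \<Rightarrow> nat \<Rightarrow> nat \<Rightarrow> nat \<Rightarrow> nat \<Rightarrow> bool" where
  "approx a d x y s \<longleftrightarrow>
     (if x = y then 0 < s
      else if x div 2 = y div 2 then twins a (x div 2) (freeze d (x div 2) s)
      else freeze d (x div 2) s < s \<and> freeze d (y div 2) s < s \<and>
        cls a d (freeze d (x div 2) s) x = cls a d (freeze d (y div 2) s) y)"

text \<open>Twins inherit the notation of their trajectory. Any other pair of elements enters at
  most once and never leaves, so a single drop to \<open>b\<close> suffices.\<close>

definition notation_approx :: "nat \<Rightarrow> nat \<Rightarrow> nat \<Rightarrow> nat \<Rightarrow> nat \<Rightarrow> nat \<Rightarrow> nat" where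
  "notation_approx a b d x y s =
     (if x \<noteq> y \<and> x div 2 = y div 2
      then pi2 (pi2 (twin_traj a (x div 2) (freeze d (x div 2) s)))
      else if approx a d x y s then b else a)"

lemma approx_monotone:
  assumes "x = y \<or> x div 2 \<noteq> y div 2" "approx a d x y s" "s \<le> s'"
  shows "approx a d x y s'"
  using assms by (auto simp: approx_def freeze_eq min_def split: if_splits)

lemma approx_eventually:
  assumes "KO a" "d < 2"
  shows "\<exists>N. \<forall>s\<ge>N. approx a d x y s \<longleftrightarrow> (x, y) \<in> rel a d"
proof -
  consider "x = y" | "x \<noteq> y" "x div 2 = y div 2" | "x div 2 \<noteq> y div 2" by blast
  then show ?thesis
  proof cases
    case 1
    then show ?thesis by (auto simp: approx_def rel_def intro: exI[of _ 1])
  next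
    case 2
    show ?thesis
    proof (cases "touched d (x div 2)")
      case True
      then show ?thesis
        using 2 touch_time_touches[OF True] cls_twin[OF assms(2) _ _ 2, of "touch_time d (x div 2)" a]
        by (auto simp: approx_def rel_def key_def freeze_eq min_def
            intro!: exI[of _ "Suc (touch_time d (x div 2))"])
    next
      case False
      then show ?thesis
        using 2 twins_eventually[OF assms(1), of "x div 2"]
        by (auto simp: approx_def rel_def key_def freeze_eq)
    qed
  next
    case 3
    \<comment> \<open>If one of the pairs is never touched, both sides below are false:
      \<open>freeze\<close> stays equal to the stage, and the keys differ.\<close>
    let ?N = "Suc (touch_time d (x div 2) + touch_time d (y div 2))"
    have "approx a d x y s \<longleftrightarrow> (x, y) \<in> rel a d" if "?N \<le> s" for s
      using that 3 by (auto simp: approx_def rel_def key_def freeze_eq min_def)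
    then show ?thesis by blast
  qed
qed

lemma rel_in_Sigma_inv:
  assumes "KO a" "0 < KO_ord a" "d < 2"
  shows "rel_code (rel a d) \<in> Sigma_inv a"
proof -
  obtain b where b: "KO b" "KO_less b a" using KO_ex_less assms(1,2) by blast
  define f :: "nat \<Rightarrow> nat \<Rightarrow> nat" where "f z s = of_bool (approx a d (pi1 z) (pi2 z) s)" for z s
  define \<gamma> where "\<gamma> z s = notation_approx a b d (pi1 z) (pi2 z) s" for z s
  have ap: "dec (\<lambda>x. approx a d (pi1 (pi1 x)) (pi2 (pi1 x)) (pi2 x))"
    unfolding approx_def by (intro cintro)
  have "computable2 f" unfolding computable2_iff f_def by (intro cintro ap)
  moreover have "computable2 \<gamma>"
    unfolding computable2_iff \<gamma>_def notation_approx_def by (intro cintro ap)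
  moreover have "(\<lambda>s. f z s) \<longlonglongrightarrow> of_bool (z \<in> rel_code (rel a d))" for z
  proof -
    have "z \<in> rel_code (rel a d) \<longleftrightarrow> (pi1 z, pi2 z) \<in> rel a d"
      unfolding rel_code_def by (metis (no_types, lifting) image_iff pi_pr surj_pair)
    then show ?thesis
      using approx_eventually[OF assms(1,3), of "pi1 z" "pi2 z"]
      by (intro tendsto_eventually) (auto simp: f_def eventually_sequentially)
  qed
  moreover have "f z 0 = 0" "\<gamma> z 0 = a" for z
    by (auto simp: f_def \<gamma>_def approx_def notation_approx_def freeze_eq twins_def twin_traj_def traj_0)
  moreover have "KO_le (\<gamma> z (Suc s)) (\<gamma> z s) \<and> KO_le (\<gamma> z s) a \<and>
            (f z (Suc s) \<noteq> f z s \<longrightarrow> \<gamma> z (Suc s) \<noteq> \<gamma> z s)" for z s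
  proof -
    define x y where "x = pi1 z" and "y = pi2 z"
    show ?thesis
    proof (cases "x \<noteq> y \<and> x div 2 = y div 2")
      case True
      let ?r = "freeze d (x div 2)"
      have f: "f z s = of_bool (twins a (x div 2) (?r s))" for s
        using True unfolding f_def x_def[symmetric] y_def[symmetric] approx_def by simp
      have g: "\<gamma> z s = pi2 (pi2 (twin_traj a (x div 2) (?r s)))" for s
        using True unfolding \<gamma>_def x_def[symmetric] y_def[symmetric] notation_approx_def by simp
      \<comment> \<open>The reading stage moves by at most one, so one step of the trajectory
        controls the step here, also at the moment of freezing.\<close>
      have "?r (Suc s) = ?r s \<or> ?r (Suc s) = Suc (?r s)" by (auto simp: freeze_eq min_def)
      then show ?thesis
        unfolding f g using twin_traj_sound[OF assms(1), of "x div 2" "?r s"] KO_le_def by fastforce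
    next
      case False
      then have "approx a d x y s \<Longrightarrow> approx a d x y (Suc s)" using approx_monotone[of x y a d s "Suc s"] by auto
      then show ?thesis
        using False b assms(1) KO_less_imp_neq[OF b(2)]
        unfolding f_def \<gamma>_def x_def[symmetric] y_def[symmetric]
        by (auto simp: notation_approx_def KO_le_def)
    qed
  qed
  ultimately show ?thesis unfolding Sigma_inv_def by blast
qed

lemma rel_not_in_Pi_inv:
  assumes "d < 2" shows "rel_code (rel a d) \<notin> Pi_inv a"
proof
  assume "rel_code (rel a d) \<in> Pi_inv a"
  then obtain f \<gamma> where f: "computable2 f" and g: "computable2 \<gamma>"
    and lim: "\<And>z. (\<lambda>t. f z t) \<longlonglongrightarrow> of_bool (z \<in> - rel_code (rel a d))"
    and 0: "\<And>z. f z 0 = 0 \<and> \<gamma> z 0 = a"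
    and st: "\<And>z t. KO_le (\<gamma> z (Suc t)) (\<gamma> z t) \<and> (f z (Suc t) \<noteq> f z t \<longrightarrow> \<gamma> z (Suc t) \<noteq> \<gamma> z t)"
    unfolding Pi_inv_def Sigma_inv_def by blast
  obtain i j where i: "\<And>x. phi i x = Some (f (pi1 x) (pi2 x))" and j: "\<And>x. phi j x = Some (\<gamma> (pi1 x) (pi2 x))"
    using f g unfolding computable2_iff computable_def by blast
  \<comment> \<open>On an untouched pair owned by the supposed approximation of the complement, the
    twins are equivalent exactly when that approximation puts their code into the
    complement.\<close>
  obtain m where m: "\<not> touched d (pr (pr i j) m)" using ex_untouched[OF assms] by blast
  define z where "z = pr (pr i j) m"
  define w where "w = pr (2 * z) (2 * z + 1)"
  let ?l = "of_bool (w \<in> - rel_code (rel a d)) :: nat"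
  obtain M where M: "\<And>t. M \<le> t \<Longrightarrow> f w t = ?l"
    using lim[of w] by (auto simp: tendsto_discrete eventually_sequentially)
  obtain N where N: "\<forall>s\<ge>N. tval a i j w s = ?l"
    using traj_complete[of i w "f w" j "\<gamma> w" a M ?l] i j 0 st M by auto
  have "twins_lim a z \<longleftrightarrow> w \<notin> rel_code (rel a d)"
  proof -
    have "twins a z s \<longleftrightarrow> w \<notin> rel_code (rel a d)" if "N \<le> s" for s
      using N that by (auto simp: twins_def twin_traj_def w_def z_def)
    then show ?thesis unfolding twins_lim_def by (metis nle_le)
  qed
  moreover have "w \<in> rel_code (rel a d) \<longleftrightarrow> twins_lim a z"
    using m unfolding rel_code_def w_def
    by (auto simp: image_iff rel_def key_def z_def)
  ultimately show False by blast
qed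

section \<open>Common lower bounds have finitely many classes\<close>

lemma act_classes:
  assumes "act t" "d < 2"
  shows "(elt d 0 t, elt d 1 t) \<in> rel a d \<longleftrightarrow> d = 0"
proof -
  have "elt d 0 t \<noteq> elt d 1 t" using assms act_iff[of t] by metis
  then have "cls a d t (elt d 0 t) = 0" "cls a d t (elt d 1 t) = d" by (auto simp: cls_def)
  then show ?thesis
    using act_touch_time[OF assms, of 0] act_touch_time[OF assms, of 1] by (auto simp: rel_def key_def)
qed

lemma finite_not_may_touch: "finite {p. \<not> may_touch e (p div 2)}"
proof -
  have "{z. \<not> may_touch e z} \<subseteq> prod_encode ` ({..e} \<times> {..2 * e})"
  proof
    fix z assume "z \<in> {z. \<not> may_touch e z}"
    then have "(pi1 z, pi2 z) \<in> {..e} \<times> {..2 * e}" by (auto simp: may_touch_def)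
    then show "z \<in> prod_encode ` ({..e} \<times> {..2 * e})" by (metis image_eqI pi_pr(3))
  qed
  then have fin: "finite {z. \<not> may_touch e z}" by (rule finite_subset) simp
  have "{p. \<not> may_touch e (p div 2)} \<subseteq> (\<lambda>(z, r). 2 * z + r) ` ({z. \<not> may_touch e z} \<times> {..<2})"
  proof
    fix p assume "p \<in> {p. \<not> may_touch e (p div 2)}"
    then have "(p div 2, p mod 2) \<in> {z. \<not> may_touch e z} \<times> {..<2}" by auto
    then show "p \<in> (\<lambda>(z, r). 2 * z + r) ` ({z. \<not> may_touch e z} \<times> {..<2})"
      by (rule rev_image_eqI) simp
  qed
  then show ?thesis using fin by (meson finite_SigmaI finite_imageI finite_lessThan finite_subset)
qed

text \<open>If \<open>X\<close> were infinite, the requirement coding both reductions would act,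
  making the images of two points equivalent on one side only; but both reductions start from the
  same \<open>T\<close>.\<close>

lemma common_lower_bound_finite:
  assumes f: "\<And>d. d < 2 \<Longrightarrow> computable (f d)"
    and T: "\<And>d x y. d < 2 \<Longrightarrow> (x, y) \<in> T \<longleftrightarrow> (f d x, f d y) \<in> rel a d"
    and X: "\<And>x y. x \<in> X \<Longrightarrow> y \<in> X \<Longrightarrow> (x, y) \<in> T \<Longrightarrow> x = y"
  shows "finite X"
proof (rule ccontr)
  assume inf: "infinite X"
  obtain i j where i: "\<And>x. phi i x = Some (f 0 x)" and j: "\<And>x. phi j x = Some (f 1 x)"
    using f[of 0] f[of 1] unfolding computable_def by auto
  define e where "e = pr i j"
  have phi: "phi (sel d e) x = Some (f d x)" if "d < 2" for d x
    using that i j by (auto simp: e_def sel_def less_2_cases_iff)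
  have "\<not> (act t \<and> req t = e)" for t
  proof
    assume t: "act t \<and> req t = e"
    have "f d (point r t) = elt d r t" if "d < 2" "r < 2" for d r
    proof -
      have "proves (crt t) (run_fact (sel d e) (point r t) (elt d r t))"
        using t that act_iff[of t] by metis
      from proves_sound[OF this] show ?thesis using phi[OF that(1)] by simp
    qed
    then have "(f d (point 0 t), f d (point 1 t)) \<in> rel a d \<longleftrightarrow> d = 0" if "d < 2" for d
      using act_classes[of t d a] t that by simp
    then show False using T[of 0] T[of 1] by (metis one_less_numeral_iff one_neq_zero pos2 semiring_norm(76))
  qed
  note no_act = this
  \<comment> \<open>These are the points whose image on side \<open>d\<close> the requirement
    \<open>e\<close> cannot use.\<close>
  define bad where
    "bad d = {x \<in> X. touched d (f d x div 2)} \<union> {x \<in> X. \<not> may_touch e (f d x div 2)}" for d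
  have key_inj: "inj_on (\<lambda>x. key a d (f d x)) X" if "d < 2" for d
    using X T[OF that] by (auto simp: inj_on_def rel_def)
  have f_inj: "inj_on (f d) X" if "d < 2" for d
    using key_inj[OF that] by (auto simp: inj_on_def)
  have fin_bad: "finite (bad d)" if "d < 2" for d
  proof -
    \<comment> \<open>Images in touched pairs have at most two keys, and on \<open>X\<close> the key
      determines the point.\<close>
    have "(\<lambda>x. key a d (f d x)) ` {x \<in> X. touched d (f d x div 2)} \<subseteq> {0} \<times> {..<2}"
      using cls_less[OF that] by (auto simp: key_def)
    then have "finite {x \<in> X. touched d (f d x div 2)}"
      by (rule inj_on_finite[rotated]) (auto intro: inj_on_subset[OF key_inj[OF that]])
    moreover have "finite {x \<in> X. \<not> may_touch e (f d x div 2)}"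
      by (rule inj_on_finite[OF inj_on_subset[OF f_inj[OF that]] _ finite_not_may_touch[of e]]) auto
    ultimately show ?thesis by (simp add: bad_def)
  qed
  have fin_same: "finite {y \<in> X. f d y div 2 = z}" if "d < 2" for d z
  proof (rule inj_on_finite[OF inj_on_subset[OF f_inj[OF that]], of _ "{2 * z, 2 * z + 1}"])
    show "f d ` {y \<in> X. f d y div 2 = z} \<subseteq> {2 * z, 2 * z + 1}" by auto
  qed auto
  have "infinite (X - bad 0 - bad 1)" using inf fin_bad by (simp add: Diff_infinite_finite)
  then obtain x where x: "x \<in> X - bad 0 - bad 1" using infinite_imp_nonempty by blast
  have "infinite (X - bad 0 - bad 1 - {y \<in> X. f 0 y div 2 = f 0 x div 2}
      - {y \<in> X. f 1 y div 2 = f 1 x div 2})"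
    using inf fin_bad fin_same by (simp add: Diff_infinite_finite)
  then obtain y where y: "y \<in> X - bad 0 - bad 1" "f 0 y div 2 \<noteq> f 0 x div 2" "f 1 y div 2 \<noteq> f 1 x div 2"
    using infinite_imp_nonempty by blast
  define v where "v r = (if r = 0 then x else y)" for r :: nat
  let ?F = "(\<lambda>(d, r). run_fact (sel d e) (v r) (f d (v r))) ` ({..<2} \<times> {..<2})"
  have "\<exists>c. \<forall>y\<in>?F. proves c y"
    by (rule holds_imp_proves) (use phi in auto)
  then obtain c where c: "proves c (run_fact (sel d e) (v r) (f d (v r)))" if "d < 2" "r < 2" for d r
    by fastforce
  \<comment> \<open>The trailing 0 is arbitrary: the four images lie in pairs that are never touched
    and \<open>e\<close> never acts, so eligibility does not depend on timing.\<close>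
  define t where
    "t = pr (pr e (pr (pr x y) (pr (pr (pr (f 0 x) (f 0 y)) (pr (f 1 x) (f 1 y))) c))) 0"
  have t: "req t = e" "crt t = c" "\<And>r. r < 2 \<Longrightarrow> point r t = v r"
    "\<And>d r. d < 2 \<Longrightarrow> r < 2 \<Longrightarrow> elt d r t = f d (v r)"
    by (auto simp: t_def req_def crt_def point_def elt_def v_def less_2_cases_iff)
  have v: "may_touch e (f d (v r) div 2)" "\<not> touched d (f d (v r) div 2)" if "d < 2" for d r
    using x y that by (auto simp: bad_def v_def less_2_cases_iff)
  have ne: "f d (v 0) div 2 \<noteq> f d (v 1) div 2" if "d < 2" for d
    using y that by (auto simp: v_def less_2_cases_iff)
  have "act t"
    unfolding act_iff[of t] using no_act c v ne unfolding touched_def by (auto simp: t)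
  then show False using no_act t(1) by blast
qed

section \<open>Relations with finitely many classes below both relations\<close>

definition fin_classes :: "nat \<Rightarrow> nat rel" where
  "fin_classes n = {(x, y). min x n = min y n}"

lemma fin_classes_in_Sigma_equivs:
  assumes "KO a" "0 < KO_ord a" shows "fin_classes n \<in> Sigma_equivs a"
proof -
  have "rel_code (fin_classes n) = {z. min (pi1 z) n = min (pi2 z) n}"
    unfolding rel_code_def fin_classes_def by (auto simp: image_iff) (metis pi_pr(3))
  moreover have "dec (\<lambda>z. min (pi1 z) n = min (pi2 z) n)"
    unfolding min_def by (intro cintro)
  ultimately have "rel_code (fin_classes n) \<in> Sigma_inv a"
    using decidable_in_Sigma_inv[OF assms] by simp
  moreover have "equiv UNIV (fin_classes n)"
    by (auto simp: fin_classes_def equiv_def refl_on_def sym_def trans_def)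
  ultimately show ?thesis by (simp add: Sigma_equivs_def)
qed

text \<open>Each \<open>k\<close> has an untouched pair with first component \<open>k\<close>, and
  elements of different untouched pairs are inequivalent. Only \<open>r 0, ..., r n\<close> are
  used, so the choice of \<open>m\<close> may be noneffective.\<close>

lemma fin_classes_le_rel:
  assumes "d < 2" shows "fin_classes n \<le>\<^sub>c rel a d"
proof -
  obtain m where m: "\<And>k. \<not> touched d (pr k (m k))" using ex_untouched[OF assms] by metis
  define r where "r k = 2 * pr k (m k)" for k
  have "key a d (r k) = key a d (r l) \<longleftrightarrow> k = l" for k l
    using m by (auto simp: key_def r_def)
  then have "(x, y) \<in> fin_classes n \<longleftrightarrow> (r (min x n), r (min y n)) \<in> rel a d" for x y
    by (simp add: fin_classes_def rel_def)
  then show ?thesis unfolding reducible_def using computable_initial_segment by blast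
qed

theorem theorem4p10:
  fixes a :: nat
  assumes "KO a" and "0 < KO_ord a"
  shows "\<exists>R S :: nat rel.
    equiv UNIV R \<and> equiv UNIV S \<and>
    rel_code R \<in> Sigma_inv a - Pi_inv a \<and>
    rel_code S \<in> Sigma_inv a - Pi_inv a \<and>
    \<not> (\<exists>T. is_infimum (Sigma_equivs a) R S T)"
proof (intro exI conjI)
  show "equiv UNIV (rel a 0)" "equiv UNIV (rel a 1)" by (rule equiv_rel)+
  show "rel_code (rel a 0) \<in> Sigma_inv a - Pi_inv a" "rel_code (rel a 1) \<in> Sigma_inv a - Pi_inv a"
    using rel_in_Sigma_inv[OF assms] rel_not_in_Pi_inv by auto
  show "\<nexists>T. is_infimum (Sigma_equivs a) (rel a 0) (rel a 1) T"
  proof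
    assume "\<exists>T. is_infimum (Sigma_equivs a) (rel a 0) (rel a 1) T"
    then obtain T where T: "T \<in> Sigma_equivs a" "T \<le>\<^sub>c rel a 0" "T \<le>\<^sub>c rel a 1"
      and glb: "\<And>Z. Z \<in> Sigma_equivs a \<Longrightarrow> Z \<le>\<^sub>c rel a 0 \<Longrightarrow> Z \<le>\<^sub>c rel a 1 \<Longrightarrow> Z \<le>\<^sub>c T"
      unfolding is_infimum_def by blast
    have eq: "equiv UNIV T" using T(1) by (simp add: Sigma_equivs_def)
    obtain g h where g: "computable g" "\<And>x y. (x, y) \<in> T \<longleftrightarrow> (g x, g y) \<in> rel a 0"
      and h: "computable h" "\<And>x y. (x, y) \<in> T \<longleftrightarrow> (h x, h y) \<in> rel a 1"
      using T(2,3) unfolding reducible_def by blast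
    \<comment> \<open>A transversal of \<open>T\<close>, so that finiteness of \<open>X\<close>
      gives finitely many classes.\<close>
    define X where "X = (\<lambda>C. SOME x. x \<in> C) ` (UNIV // T)"
    have rep: "(SOME x. x \<in> C) \<in> C" if "C \<in> UNIV // T" for C
      using that eq by (metis equiv_Eps_in)
    have "finite X"
    proof (rule common_lower_bound_finite)
      show "computable ((\<lambda>d. if d = 0 then g else h) d)" for d :: nat using g h by simp
      show "(x, y) \<in> T \<longleftrightarrow> ((\<lambda>d. if d = 0 then g else h) d x, (\<lambda>d. if d = 0 then g else h) d y) \<in> rel a d"
        if "d < 2" for d x y
        using that g(2)[of x y] h(2)[of x y] by (auto simp: less_2_cases_iff)
      show "x = y" if "x \<in> X" "y \<in> X" "(x, y) \<in> T" for x y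
        using that rep quotient_eqI[OF eq] unfolding X_def by blast
    qed
    moreover have "inj_on (\<lambda>C. SOME x. x \<in> C) (UNIV // T)"
    proof (rule inj_onI)
      fix C D assume "C \<in> UNIV // T" "D \<in> UNIV // T" "(SOME x. x \<in> C) = (SOME x. x \<in> D)"
      then show "C = D" using rep[of C] rep[of D] quotient_disj[OF eq, of C D] by auto
    qed
    ultimately have fin: "finite (UNIV // T)" unfolding X_def by (rule finite_imageD)
    let ?n = "card (UNIV // T)"
    have "fin_classes ?n \<le>\<^sub>c T"
      using glb fin_classes_in_Sigma_equivs[OF assms] fin_classes_le_rel by simp
    then obtain k where k: "\<And>x y. (x, y) \<in> fin_classes ?n \<longleftrightarrow> (k x, k y) \<in> T"
      unfolding reducible_def by blast
    \<comment> \<open>\<open>fin_classes ?n\<close> has \<open>?n + 1\<close> classes, one more than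
      \<open>T\<close>, and the reduction \<open>k\<close> keeps them apart.\<close>
    have "inj_on (\<lambda>x. T `` {k x}) {..?n}"
    proof (rule inj_onI)
      fix x y assume "x \<in> {..?n}" "y \<in> {..?n}" "T `` {k x} = T `` {k y}"
      then show "x = y"
        using k[of x y] eq_equiv_class_iff[OF eq] by (simp add: fin_classes_def)
    qed
    moreover have "(\<lambda>x. T `` {k x}) ` {..?n} \<subseteq> UNIV // T" by (auto intro: quotientI)
    ultimately have "card {..?n} \<le> ?n" using fin by (rule card_inj_on_le)
    then show False by simp
  qed
qed

end
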